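(* Let $S$ be an infinite discrete weakly cancellative semigroup, let $\omega$ be a weight on $S$, and let $\mathcal A=l^1(S,\omega)$. If $S$ is unital or $S$ is cancellative, then $c_0(S)$ is not a bi-injective Banach $\mathcal A$-bimodule.
   Context: Weight $\omega$: $\omega(st)\le\omega(s)\omega(t)$, $\omega>0$, $\omega(u_S)=1$ if $S$ unital; $\Omega(g,h)=\omega(gh)\omega(g)^{-1}\omega(h)^{-1}$; $l^1(S,\omega)$ is $l^1(S)$ with $\delta_g\star\delta_h=\Omega(g,h)\delta_{gh}$; weakly cancellative: $t\mapsto st$, $t\mapsto ts$ finite-to-one for each $s$. $c_0(S)$ is a sub-bimodule of $l^\infty(S)=\mathcal A'$ with actions $\langle a\cdot\mu,b\rangle=\mu(ba)$, $\langle\mu\cdot a,b\rangle=\mu(ab)$. A Banach $\mathcal A$-bimodule $E$ is bi-injective if whenever $F,G$ are Banach $\mathcal A$-bimodules, $\theta:F\to G$ is an injective bounded bimodule homomorphism whose range is closed and complemented, and $\sigma:F\to E$ is a bounded bimodule homomorphism, there exists a bounded bimodule homomorphism $\rho:G\to E$ with $\rho\circ\theta=\sigma$. *)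

theory Defs
  imports "HOL-Analysis.Analysis"
begin

definition weakly_cancellative :: "'s::semigroup_mult itself \<Rightarrow> bool" where
  "weakly_cancellative _ \<longleftrightarrow>
     (\<forall>s::'s. \<forall>u. finite {t. s * t = u} \<and> finite {t. t * s = u})"

definition cancellative :: "'s::semigroup_mult itself \<Rightarrow> bool" where
  "cancellative _ \<longleftrightarrow> (\<forall>s::'s. inj (\<lambda>t. s * t) \<and> inj (\<lambda>t. t * s))"

definition is_unit_of :: "'s::semigroup_mult \<Rightarrow> bool" where
  "is_unit_of u \<longleftrightarrow> (\<forall>s. u * s = s \<and> s * u = s)"

definition unital :: "'s::semigroup_mult itself \<Rightarrow> bool" where
  "unital _ \<longleftrightarrow> (\<exists>u::'s. is_unit_of u)"

definition weight :: "('s::semigroup_mult \<Rightarrow> real) \<Rightarrow> bool" where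
  "weight \<omega> \<longleftrightarrow> (\<forall>s. \<omega> s > 0) \<and> (\<forall>s t. \<omega> (s * t) \<le> \<omega> s * \<omega> t)
     \<and> (\<forall>u. is_unit_of u \<longrightarrow> \<omega> u = 1)"

definition Omega :: "('s::semigroup_mult \<Rightarrow> real) \<Rightarrow> 's \<Rightarrow> 's \<Rightarrow> real" where
  "Omega \<omega> g h = \<omega> (g * h) / (\<omega> g * \<omega> h)"

definition l1 :: "('s \<Rightarrow> complex) set" where
  "l1 = {f. (\<lambda>s. norm (f s)) summable_on UNIV}"

definition l1norm :: "('s \<Rightarrow> complex) \<Rightarrow> real" where
  "l1norm f = (\<Sum>\<^sub>\<infinity>s. norm (f s))"

text \<open>Product of l^1(S,omega): delta_g * delta_h = Omega(g,h) delta_{gh}.\<close>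
definition conv :: "('s::semigroup_mult \<Rightarrow> real) \<Rightarrow> ('s \<Rightarrow> complex) \<Rightarrow> ('s \<Rightarrow> complex) \<Rightarrow> 's \<Rightarrow> complex" where
  "conv \<omega> f g u = (\<Sum>\<^sub>\<infinity>(s,t)\<in>{(s,t). s * t = u}. f s * g t * complex_of_real (Omega \<omega> s t))"

definition delta :: "'s \<Rightarrow> 's \<Rightarrow> complex" where
  "delta s = (\<lambda>t. if t = s then 1 else 0)"

definition cscale :: "complex \<Rightarrow> ('s \<Rightarrow> complex) \<Rightarrow> 's \<Rightarrow> complex" where
  "cscale c f = (\<lambda>s. c * f s)"

record ('s, 'v) bimod =
  vcarrier :: "'v set"
  vzero :: 'v
  vadd :: "'v \<Rightarrow> 'v \<Rightarrow> 'v"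
  vscal :: "complex \<Rightarrow> 'v \<Rightarrow> 'v"
  vnorm :: "'v \<Rightarrow> real"
  lact :: "('s \<Rightarrow> complex) \<Rightarrow> 'v \<Rightarrow> 'v"
  ract :: "'v \<Rightarrow> ('s \<Rightarrow> complex) \<Rightarrow> 'v"

definition vsub :: "('s, 'v) bimod \<Rightarrow> 'v \<Rightarrow> 'v \<Rightarrow> 'v" where
  "vsub M x y = vadd M x (vscal M (-1) y)"

definition cbanach :: "('s, 'v) bimod \<Rightarrow> bool" where
  "cbanach M \<longleftrightarrow>
    vzero M \<in> vcarrier M \<and>
    (\<forall>x\<in>vcarrier M. \<forall>y\<in>vcarrier M. vadd M x y \<in> vcarrier M) \<and>
    (\<forall>c. \<forall>x\<in>vcarrier M. vscal M c x \<in> vcarrier M) \<and>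
    (\<forall>x\<in>vcarrier M. \<forall>y\<in>vcarrier M. \<forall>z\<in>vcarrier M.
        vadd M (vadd M x y) z = vadd M x (vadd M y z)) \<and>
    (\<forall>x\<in>vcarrier M. \<forall>y\<in>vcarrier M. vadd M x y = vadd M y x) \<and>
    (\<forall>x\<in>vcarrier M. vadd M x (vzero M) = x) \<and>
    (\<forall>x\<in>vcarrier M. vadd M x (vscal M (-1) x) = vzero M) \<and>
    (\<forall>x\<in>vcarrier M. vscal M 1 x = x) \<and>
    (\<forall>a b. \<forall>x\<in>vcarrier M. vscal M (a * b) x = vscal M a (vscal M b x)) \<and>
    (\<forall>a b. \<forall>x\<in>vcarrier M. vscal M (a + b) x = vadd M (vscal M a x) (vscal M b x)) \<and>
    (\<forall>a. \<forall>x\<in>vcarrier M. \<forall>y\<in>vcarrier M. vscal M a (vadd M x y) = vadd M (vscal M a x) (vscal M a y)) \<and>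
    (\<forall>x\<in>vcarrier M. vnorm M x \<ge> 0 \<and> (vnorm M x = 0 \<longleftrightarrow> x = vzero M)) \<and>
    (\<forall>x\<in>vcarrier M. \<forall>y\<in>vcarrier M. vnorm M (vadd M x y) \<le> vnorm M x + vnorm M y) \<and>
    (\<forall>c. \<forall>x\<in>vcarrier M. vnorm M (vscal M c x) = cmod c * vnorm M x) \<and>
    (\<forall>X::nat \<Rightarrow> 'v. (\<forall>n. X n \<in> vcarrier M) \<and>
        (\<forall>e>0. \<exists>N. \<forall>m\<ge>N. \<forall>n\<ge>N. vnorm M (vsub M (X m) (X n)) < e)
        \<longrightarrow> (\<exists>x\<in>vcarrier M. (\<lambda>n. vnorm M (vsub M (X n) x)) \<longlonglongrightarrow> 0))"

definition banach_bimod :: "('s::semigroup_mult \<Rightarrow> real) \<Rightarrow> ('s, 'v) bimod \<Rightarrow> bool" where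
  "banach_bimod \<omega> M \<longleftrightarrow> cbanach M \<and>
    (\<forall>a\<in>l1. \<forall>x\<in>vcarrier M. lact M a x \<in> vcarrier M \<and> ract M x a \<in> vcarrier M) \<and>
    (\<forall>a\<in>l1. \<forall>b\<in>l1. \<forall>x\<in>vcarrier M.
        lact M (\<lambda>s. a s + b s) x = vadd M (lact M a x) (lact M b x) \<and>
        ract M x (\<lambda>s. a s + b s) = vadd M (ract M x a) (ract M x b)) \<and>
    (\<forall>a\<in>l1. \<forall>c. \<forall>x\<in>vcarrier M.
        lact M (cscale c a) x = vscal M c (lact M a x) \<and>
        ract M x (cscale c a) = vscal M c (ract M x a) \<and>
        lact M a (vscal M c x) = vscal M c (lact M a x) \<and>
        ract M (vscal M c x) a = vscal M c (ract M x a)) \<and>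
    (\<forall>a\<in>l1. \<forall>x\<in>vcarrier M. \<forall>y\<in>vcarrier M.
        lact M a (vadd M x y) = vadd M (lact M a x) (lact M a y) \<and>
        ract M (vadd M x y) a = vadd M (ract M x a) (ract M y a)) \<and>
    (\<forall>a\<in>l1. \<forall>b\<in>l1. \<forall>x\<in>vcarrier M.
        lact M (conv \<omega> a b) x = lact M a (lact M b x) \<and>
        ract M x (conv \<omega> a b) = ract M (ract M x a) b \<and>
        ract M (lact M a x) b = lact M a (ract M x b)) \<and>
    (\<exists>C. \<forall>a\<in>l1. \<forall>x\<in>vcarrier M.
        vnorm M (lact M a x) \<le> C * l1norm a * vnorm M x \<and>
        vnorm M (ract M x a) \<le> C * l1norm a * vnorm M x)"

definition bounded_clinear_on :: "('s, 'v) bimod \<Rightarrow> ('s, 'w) bimod \<Rightarrow> ('v \<Rightarrow> 'w) \<Rightarrow> bool" where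
  "bounded_clinear_on M N T \<longleftrightarrow>
    (\<forall>x\<in>vcarrier M. T x \<in> vcarrier N) \<and>
    (\<forall>x\<in>vcarrier M. \<forall>y\<in>vcarrier M. T (vadd M x y) = vadd N (T x) (T y)) \<and>
    (\<forall>c. \<forall>x\<in>vcarrier M. T (vscal M c x) = vscal N c (T x)) \<and>
    (\<exists>C. \<forall>x\<in>vcarrier M. vnorm N (T x) \<le> C * vnorm M x)"

definition bimod_hom :: "('s, 'v) bimod \<Rightarrow> ('s, 'w) bimod \<Rightarrow> ('v \<Rightarrow> 'w) \<Rightarrow> bool" where
  "bimod_hom M N T \<longleftrightarrow> bounded_clinear_on M N T \<and>
    (\<forall>a\<in>l1. \<forall>x\<in>vcarrier M. T (lact M a x) = lact N a (T x) \<and> T (ract M x a) = ract N (T x) a)"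

definition closed_in_bimod :: "('s, 'v) bimod \<Rightarrow> 'v set \<Rightarrow> bool" where
  "closed_in_bimod M W \<longleftrightarrow>
    (\<forall>X y. (\<forall>n. X n \<in> W) \<and> y \<in> vcarrier M \<and> (\<lambda>n. vnorm M (vsub M (X n) y)) \<longlonglongrightarrow> 0
       \<longrightarrow> y \<in> W)"

definition complemented_in :: "('s, 'v) bimod \<Rightarrow> 'v set \<Rightarrow> bool" where
  "complemented_in M W \<longleftrightarrow>
    (\<exists>P. bounded_clinear_on M M P \<and> (\<forall>x\<in>vcarrier M. P (P x) = P x) \<and> P ` vcarrier M = W)"

text \<open>Bi-injectivity. Since HOL cannot quantify over types inside a formula, the test bimodules
  F, G range over all Banach bimodules whose carriers live in the types 'f and 'g.\<close>
definition bi_injective ::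
  "'f itself \<Rightarrow> 'g itself \<Rightarrow> ('s::semigroup_mult \<Rightarrow> real) \<Rightarrow> ('s, 'e) bimod \<Rightarrow> bool" where
  "bi_injective _ _ \<omega> E \<longleftrightarrow>
    (\<forall>(F::('s,'f) bimod) (G::('s,'g) bimod) \<theta> \<sigma>.
       banach_bimod \<omega> F \<and> banach_bimod \<omega> G \<and> bimod_hom F G \<theta> \<and> inj_on \<theta> (vcarrier F) \<and>
       closed_in_bimod G (\<theta> ` vcarrier F) \<and> complemented_in G (\<theta> ` vcarrier F) \<and>
       bimod_hom F E \<sigma>
       \<longrightarrow> (\<exists>\<rho>. bimod_hom G E \<rho> \<and> (\<forall>x\<in>vcarrier F. \<rho> (\<theta> x) = \<sigma> x)))"

section \<open>The bimodule c_0(S), a sub-bimodule of l^infinity(S) = A'\<close>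

definition c0 :: "('s \<Rightarrow> complex) set" where
  "c0 = {\<mu>. \<forall>e>0. finite {s. cmod (\<mu> s) \<ge> e}}"

definition pairing :: "('s \<Rightarrow> complex) \<Rightarrow> ('s \<Rightarrow> complex) \<Rightarrow> complex" where
  "pairing \<mu> b = (\<Sum>\<^sub>\<infinity>s. \<mu> s * b s)"

text \<open><a.mu, b> = mu(b a), <mu.a, b> = mu(a b); evaluated at delta_t.\<close>
definition c0_bimod :: "('s::semigroup_mult \<Rightarrow> real) \<Rightarrow> ('s, 's \<Rightarrow> complex) bimod" where
  "c0_bimod \<omega> = \<lparr> vcarrier = c0, vzero = (\<lambda>_. 0), vadd = (\<lambda>x y s. x s + y s),
     vscal = (\<lambda>c x s. c * x s), vnorm = (\<lambda>x. Sup (range (\<lambda>s. cmod (x s)))),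
     lact = (\<lambda>a \<mu> t. pairing \<mu> (conv \<omega> (delta t) a)),
     ract = (\<lambda>\<mu> a t. pairing \<mu> (conv \<omega> a (delta t))) \<rparr>"

end

theory Submission
  imports Defs
begin

text \<open>
  Let \<open>G\<close> be the bimodule of bounded functions from the unitization \<open>S\<^sup>#\<close> to \<open>c\<^sub>0(S)\<close>. Evaluation at the
  adjoined unit complements the embedding \<open>f \<mapsto> ((a, t) \<mapsto> f (t a))\<close> of \<open>c\<^sub>0(S)\<close>, so bi-injectivity
  yields a bimodule retraction \<open>\<rho>\<close> of \<open>G\<close> onto \<open>c\<^sub>0(S)\<close>.

  If \<open>S\<close> is cancellative, apply \<open>\<rho>\<close> to the indicator \<open>f\<close> of \<open>{(a s, t). t a s = x s}\<close>. Its left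
  translate by \<open>s\<close> is the image of the indicator of \<open>x\<close>, whence \<open>\<rho> f (x s) = 1\<close>; but its right
  translate by \<open>x\<close> is supported where \<open>t a s = s\<close>, which makes \<open>t a\<close> a unit. So \<open>S\<close> is unital.

  If \<open>S\<close> has a unit \<open>e\<close>, then \<open>\<rho> f x = \<rho> (x \<cdot> f) e\<close>. For a sequence \<open>x\<^sub>n\<close> of distinct points and sets
  \<open>N\<^sub>j\<close> increasing to \<open>S\<^sup>#\<close>, chosen such that each \<open>(a, t)\<close> satisfies \<open>t a x\<^sub>n = x\<^sub>n\<close>, \<open>a x\<^sub>n \<in> N\<^sub>j\<close> for
  at most \<open>j\<close> indices \<open>n\<close>, this makes \<open>\<rho> (1[t a = x\<^sub>n, a \<in> N\<^sub>j]) x\<^sub>n\<close> absolutely summable over \<open>n\<close>. After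
  passing to a subsequence, \<open>A \<mapsto> \<rho> (\<Sum>n\<in>A. \<omega> x\<^sub>n 1[t a = x\<^sub>n, a \<notin> N\<^sub>n])\<close> therefore extends to an operator
  from \<open>l\<^sup>\<infinity>\<close> to \<open>c\<^sub>0\<close> whose diagonal stays away from \<open>0\<close>, contradicting Phillips's lemma.
\<close>

section \<open>Sums over the weighted convolution algebra\<close>

lemma l1_abs_summable: "a \<in> l1 \<Longrightarrow> (\<lambda>s. norm (a s)) summable_on UNIV"
  by (simp add: l1_def)

lemma l1_mult_abs_summable:
  assumes "a \<in> l1" "\<And>s. norm (g s) \<le> B"
  shows "(\<lambda>s. norm (a s * g s)) summable_on UNIV"
proof (rule Infinite_Sum.abs_summable_on_comparison_test')
  show "(\<lambda>s. norm (a s) * B) summable_on UNIV"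
    using l1_abs_summable[OF assms(1)] by (rule summable_on_cmult_left)
  show "norm (a s * g s) \<le> norm (a s) * B" for s
    by (simp add: norm_mult mult_left_mono assms(2))
qed

lemma l1_mult_summable:
  assumes "a \<in> l1" "\<And>s. norm (g s) \<le> B"
  shows "(\<lambda>s. a s * g s :: complex) summable_on UNIV"
  using l1_mult_abs_summable[OF assms] by (rule abs_summable_summable)

lemma l1_mult_norm_le:
  assumes "a \<in> l1" "\<And>s. norm (g s) \<le> B"
  shows "norm (\<Sum>\<^sub>\<infinity>s. a s * g s) \<le> l1norm a * B"
proof -
  have "norm (\<Sum>\<^sub>\<infinity>s. a s * g s) \<le> (\<Sum>\<^sub>\<infinity>s. norm (a s * g s))"
    by (rule norm_infsum_bound) (rule l1_mult_abs_summable[OF assms])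
  also have "\<dots> \<le> (\<Sum>\<^sub>\<infinity>s. norm (a s) * B)"
    by (intro infsum_mono l1_mult_abs_summable[OF assms] summable_on_cmult_left l1_abs_summable assms(1))
      (simp add: norm_mult mult_left_mono assms(2))
  also have "\<dots> = l1norm a * B"
    unfolding l1norm_def by (simp add: infsum_cmult_left')
  finally show ?thesis .
qed

text \<open>By Tonelli, absolute summability on the product follows from the inner sums, which are
  at most \<open>norm (a s) * (l1norm b * B)\<close>. Every later exchange or regrouping of double
  sums rests on it.\<close>

lemma l1_tensor_summable:
  assumes "a \<in> l1" "b \<in> l1" "\<And>s t. norm (g s t) \<le> B"
  shows "(\<lambda>(s, t). a s * b t * g s t :: complex) summable_on UNIV \<times> UNIV"
proof (rule abs_summable_summable)
  have B: "B \<ge> 0"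
    using assms(3)[of undefined undefined] norm_ge_zero order_trans by blast
  have le: "norm (b t * g s t) \<le> norm (b t) * B" for s t
    by (simp add: norm_mult mult_left_mono assms(3))
  have sb: "(\<lambda>t. norm (b t * g s t)) summable_on UNIV" for s
    by (rule l1_mult_abs_summable[OF assms(2,3)])
  have nb: "(\<Sum>\<^sub>\<infinity>t. norm (b t * g s t)) \<le> l1norm b * B" for s
  proof -
    have "(\<Sum>\<^sub>\<infinity>t. norm (b t * g s t)) \<le> (\<Sum>\<^sub>\<infinity>t. norm (b t) * B)"
      by (intro infsum_mono sb summable_on_cmult_left l1_abs_summable assms(2) le)
    then show ?thesis
      by (simp add: l1norm_def infsum_cmult_left')
  qed
  have eq: "norm (a s * b t * g s t) = norm (a s) * norm (b t * g s t)" for s t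
    by (simp add: norm_mult mult.assoc)
  show "(\<lambda>p. norm (case p of (s, t) \<Rightarrow> a s * b t * g s t)) summable_on UNIV \<times> UNIV"
    unfolding Infinite_Sum.abs_summable_on_Sigma_iff
  proof (intro conjI ballI)
    show "(\<lambda>t. norm (case (s, t) of (s, t) \<Rightarrow> a s * b t * g s t)) summable_on UNIV" for s
      unfolding prod.case eq using sb by (rule summable_on_cmult_right)
    show "(\<lambda>s. norm (\<Sum>\<^sub>\<infinity>t\<in>UNIV. norm (case (s, t) of (s, t) \<Rightarrow> a s * b t * g s t))) summable_on UNIV"
    proof (rule Infinite_Sum.abs_summable_on_comparison_test')
      show "(\<lambda>s. norm (a s) * (l1norm b * B)) summable_on UNIV"
        by (intro summable_on_cmult_left l1_abs_summable assms)
      show "norm (\<Sum>\<^sub>\<infinity>t\<in>UNIV. norm (case (s, t) of (s, t) \<Rightarrow> a s * b t * g s t)) \<le> norm (a s) * (l1norm b * B)" for s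
        unfolding prod.case eq
        by (simp add: infsum_cmult_right' infsum_nonneg abs_mult mult_left_mono nb)
    qed
  qed
qed

lemma l1_iterated_sum_swap:
  assumes "a \<in> l1" "b \<in> l1" "\<And>s t. norm (g s t) \<le> B"
  shows "(\<Sum>\<^sub>\<infinity>s. a s * (\<Sum>\<^sub>\<infinity>t. b t * g s t)) = (\<Sum>\<^sub>\<infinity>t. b t * (\<Sum>\<^sub>\<infinity>s. a s * g s t :: complex))"
proof -
  have "(\<Sum>\<^sub>\<infinity>s. a s * (\<Sum>\<^sub>\<infinity>t. b t * g s t)) = (\<Sum>\<^sub>\<infinity>s. \<Sum>\<^sub>\<infinity>t. a s * b t * g s t)"
    by (simp add: infsum_cmult_right' mult.assoc)
  also have "\<dots> = (\<Sum>\<^sub>\<infinity>t. \<Sum>\<^sub>\<infinity>s. a s * b t * g s t)"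
    by (rule infsum_swap_banach) (rule l1_tensor_summable[OF assms])
  also have "\<dots> = (\<Sum>\<^sub>\<infinity>t. b t * (\<Sum>\<^sub>\<infinity>s. a s * g s t))"
    by (simp add: infsum_cmult_right'[symmetric] mult_ac)
  finally show ?thesis .
qed

lemma Omega_bounds:
  assumes "weight \<omega>"
  shows "0 \<le> Omega \<omega> s t" "Omega \<omega> s t \<le> 1"
  using assms unfolding weight_def Omega_def by (simp_all add: less_imp_le)

text \<open>Since \<open>Omega \<omega>\<close> takes values in [0, 1], the double series is
  absolutely summable and may be grouped by the value of \<open>s * t\<close>. Pairing a convolution
  with a bounded function thus becomes an iterated sum.\<close>

lemma conv_sum:
  fixes \<omega> :: "'s::semigroup_mult \<Rightarrow> real"
  assumes \<omega>: "weight \<omega>" and a: "a \<in> l1" and b: "b \<in> l1" and g: "\<And>u. norm (g u) \<le> B"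
  shows "(\<Sum>\<^sub>\<infinity>u. conv \<omega> a b u * g u) = (\<Sum>\<^sub>\<infinity>s. a s * (\<Sum>\<^sub>\<infinity>t. b t * (of_real (Omega \<omega> s t) * g (s * t))))"
proof -
  let ?h = "\<lambda>(s, t). a s * b t * (of_real (Omega \<omega> s t) * g (s * t))"
  let ?Q = "SIGMA u:UNIV. {(s, t). s * t = u}"
  have bound: "norm (of_real (Omega \<omega> s t) * g (s * t)) \<le> B" for s t
    using mult_mono[OF Omega_bounds(2)[OF \<omega>, of s t] g[of "s * t"]] Omega_bounds(1)[OF \<omega>, of s t]
    by (simp add: norm_mult)
  have summ: "?h summable_on UNIV \<times> UNIV"
    by (rule l1_tensor_summable[OF a b bound])
  \<comment> \<open>Each pair lies in exactly one fibre of the multiplication, so forgetting its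
    product is a bijection.\<close>
  have bij: "bij_betw snd ?Q (UNIV \<times> UNIV)"
    by (auto simp: bij_betw_def inj_on_def image_iff)
  have summQ: "(\<lambda>q. ?h (snd q)) summable_on ?Q"
    using summ summable_on_reindex_bij_betw[OF bij, of ?h] by simp
  have "(\<Sum>\<^sub>\<infinity>u. conv \<omega> a b u * g u) = (\<Sum>\<^sub>\<infinity>u. \<Sum>\<^sub>\<infinity>p\<in>{(s, t). s * t = u}. ?h p)"
    unfolding conv_def infsum_cmult_left'[symmetric]
    by (intro infsum_cong) (auto simp: mult_ac)
  also have "\<dots> = infsum (\<lambda>q. ?h (snd q)) ?Q"
    using infsum_Sigma_banach[OF summQ] by simp
  also have "\<dots> = infsum ?h (UNIV \<times> UNIV)"
    by (rule infsum_reindex_bij_betw[OF bij])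
  also have "\<dots> = (\<Sum>\<^sub>\<infinity>s. \<Sum>\<^sub>\<infinity>t. a s * b t * (of_real (Omega \<omega> s t) * g (s * t)))"
    using infsum_Sigma_banach[OF summ] by simp
  finally show ?thesis
    by (simp add: infsum_cmult_right' mult.assoc)
qed

lemma delta_in_l1: "delta s \<in> l1"
proof -
  have "(\<lambda>t. norm (delta s t)) summable_on {s}" by (rule summable_on_finite) simp
  then have "(\<lambda>t. norm (delta s t)) summable_on UNIV"
    by (rule summable_on_cong_neutral[THEN iffD1, rotated -1]) (auto simp: delta_def)
  then show ?thesis by (simp add: l1_def)
qed

lemma sum_delta: "(\<Sum>\<^sub>\<infinity>t. delta s t * f t) = f s"
proof -
  have "(\<Sum>\<^sub>\<infinity>t. delta s t * f t) = (\<Sum>\<^sub>\<infinity>t\<in>{s}. delta s t * f t)"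
    by (rule infsum_cong_neutral) (auto simp: delta_def)
  then show ?thesis by (simp add: delta_def)
qed

section \<open>Bimodules of functions on a set with translations\<close>

definition sup_norm :: "('i \<Rightarrow> complex) \<Rightarrow> real" where
  "sup_norm x = Sup (range (\<lambda>i. cmod (x i)))"

lemma sup_norm_upper:
  assumes "bounded (range x)"
  shows "cmod (x i) \<le> sup_norm x"
proof -
  obtain B where "\<And>i. cmod (x i) \<le> B"
    using assms unfolding bounded_iff by auto
  then show ?thesis
    unfolding sup_norm_def by (intro cSup_upper bdd_aboveI[of _ B]) auto
qed

lemma sup_norm_least: "(\<And>i. cmod (x i) \<le> B) \<Longrightarrow> sup_norm x \<le> B"
  unfolding sup_norm_def by (rule cSup_least) auto

lemma sup_norm_nonneg: "bounded (range x) \<Longrightarrow> 0 \<le> sup_norm x"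
  by (rule order_trans[OF norm_ge_zero sup_norm_upper])

lemma bounded_rangeI: "(\<And>i. cmod (x i) \<le> B) \<Longrightarrow> bounded (range x)"
  unfolding bounded_iff by auto

text \<open>A constant \<open>\<pi>\<close> gives \<open>c0\<close>, and \<open>fst\<close> on
  \<open>'s option \<times> 's\<close> gives the bounded functions from the unitization to
  \<open>c0\<close>; one construction thus covers both test bimodules.\<close>

definition fibre_c0 :: "('i \<Rightarrow> 'j) \<Rightarrow> ('i \<Rightarrow> complex) set" where
  "fibre_c0 \<pi> = {x. bounded (range x) \<and> (\<forall>j e. e > 0 \<longrightarrow> finite {i. \<pi> i = j \<and> e \<le> cmod (x i)})}"

lemma fibre_c0_bounded: "x \<in> fibre_c0 \<pi> \<Longrightarrow> bounded (range x)"
  by (simp add: fibre_c0_def)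

lemma fibre_c0_finite: "x \<in> fibre_c0 \<pi> \<Longrightarrow> e > 0 \<Longrightarrow> finite {i. \<pi> i = j \<and> e \<le> cmod (x i)}"
  by (simp add: fibre_c0_def)

lemma fibre_c0_norm_le: "x \<in> fibre_c0 \<pi> \<Longrightarrow> cmod (x i) \<le> sup_norm x"
  by (intro sup_norm_upper fibre_c0_bounded)

lemma fibre_c0_sup_norm_nonneg: "x \<in> fibre_c0 \<pi> \<Longrightarrow> 0 \<le> sup_norm x"
  by (intro sup_norm_nonneg fibre_c0_bounded)

lemma fibre_c0_zero: "(\<lambda>_. 0) \<in> fibre_c0 \<pi>"
  by (auto simp: fibre_c0_def)

lemma fibre_c0_add:
  assumes x: "x \<in> fibre_c0 \<pi>" and y: "y \<in> fibre_c0 \<pi>"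
  shows "(\<lambda>i. x i + y i) \<in> fibre_c0 \<pi>"
  unfolding fibre_c0_def mem_Collect_eq
proof (intro conjI allI impI)
  have "cmod (x i + y i) \<le> sup_norm x + sup_norm y" for i
    using norm_triangle_ineq[of "x i" "y i"] fibre_c0_norm_le[OF x, of i] fibre_c0_norm_le[OF y, of i] by linarith
  then show "bounded (range (\<lambda>i. x i + y i))" by (rule bounded_rangeI)
  fix j and e :: real assume e: "e > 0"
  have "{i. \<pi> i = j \<and> e \<le> cmod (x i + y i)}
      \<subseteq> {i. \<pi> i = j \<and> e/2 \<le> cmod (x i)} \<union> {i. \<pi> i = j \<and> e/2 \<le> cmod (y i)}"
  proof
    fix i assume "i \<in> {i. \<pi> i = j \<and> e \<le> cmod (x i + y i)}"
    then show "i \<in> {i. \<pi> i = j \<and> e/2 \<le> cmod (x i)} \<union> {i. \<pi> i = j \<and> e/2 \<le> cmod (y i)}"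
      using norm_triangle_ineq[of "x i" "y i"] by (auto simp: not_le)
  qed
  then show "finite {i. \<pi> i = j \<and> e \<le> cmod (x i + y i)}"
    by (rule finite_subset)
      (intro finite_UnI fibre_c0_finite[OF x half_gt_zero[OF e]] fibre_c0_finite[OF y half_gt_zero[OF e]])
qed

lemma fibre_c0_scale:
  assumes x: "x \<in> fibre_c0 \<pi>"
  shows "(\<lambda>i. c * x i) \<in> fibre_c0 \<pi>"
proof (cases "c = 0")
  case True
  then show ?thesis by (simp add: fibre_c0_zero)
next
  case False
  have "cmod (c * x i) \<le> cmod c * sup_norm x" for i
    by (simp add: norm_mult mult_left_mono fibre_c0_norm_le[OF x])
  then have "bounded (range (\<lambda>i. c * x i))" by (rule bounded_rangeI)
  moreover have "finite {i. \<pi> i = j \<and> e \<le> cmod (c * x i)}" if "e > 0" for j e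
    using fibre_c0_finite[OF x, of "e / cmod c" j] that False
    by (simp add: norm_mult pos_divide_le_eq mult.commute)
  ultimately show ?thesis
    by (simp add: fibre_c0_def)
qed

lemma fibre_c0_sum:
  "(\<And>k. k \<in> A \<Longrightarrow> f k \<in> fibre_c0 \<pi>) \<Longrightarrow> (\<lambda>i. \<Sum>k\<in>A. f k i) \<in> fibre_c0 \<pi>"
  by (induction A rule: infinite_finite_induct) (simp_all add: fibre_c0_zero fibre_c0_add)

text \<open>Points where the limit is at least \<open>e\<close> are points where a close approximant
  is at least \<open>e / 2\<close>. This serves both for completeness and for infinite sums of
  translates.\<close>

lemma fibre_c0_uniform_limit:
  assumes "\<And>e. e > 0 \<Longrightarrow> \<exists>x\<in>fibre_c0 \<pi>. \<forall>i. cmod (y i - x i) \<le> e"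
  shows "y \<in> fibre_c0 \<pi>"
  unfolding fibre_c0_def mem_Collect_eq
proof (intro conjI allI impI)
  obtain x where x: "x \<in> fibre_c0 \<pi>" "\<And>i. cmod (y i - x i) \<le> 1"
    using assms[of 1] by auto
  have "cmod (y i) \<le> sup_norm x + 1" for i
    using norm_triangle_ineq2[of "y i" "x i"] x(2)[of i] fibre_c0_norm_le[OF x(1), of i] by linarith
  then show "bounded (range y)" by (rule bounded_rangeI)
  fix j and e :: real assume e: "e > 0"
  obtain z where z: "z \<in> fibre_c0 \<pi>" "\<And>i. cmod (y i - z i) \<le> e / 2"
    using assms[of "e/2"] e by auto
  have "{i. \<pi> i = j \<and> e \<le> cmod (y i)} \<subseteq> {i. \<pi> i = j \<and> e / 2 \<le> cmod (z i)}"
  proof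
    fix i assume "i \<in> {i. \<pi> i = j \<and> e \<le> cmod (y i)}"
    then show "i \<in> {i. \<pi> i = j \<and> e / 2 \<le> cmod (z i)}"
      using norm_triangle_ineq2[of "y i" "z i"] z(2)[of i] by auto
  qed
  then show "finite {i. \<pi> i = j \<and> e \<le> cmod (y i)}"
    by (rule finite_subset) (rule fibre_c0_finite[OF z(1) half_gt_zero[OF e]])
qed

text \<open>After multiplication of functions by \<open>w\<close>, the element
  \<open>delta s\<close> acts as composition with \<open>l s\<close>, divided by
  \<open>\<omega> s\<close>. The quotient of weights expresses this for sup-normalised
  functions.\<close>

definition weighted_act :: "('s \<Rightarrow> real) \<Rightarrow> ('i \<Rightarrow> real) \<Rightarrow> ('s \<Rightarrow> 'i \<Rightarrow> 'i)
    \<Rightarrow> ('s \<Rightarrow> complex) \<Rightarrow> ('i \<Rightarrow> complex) \<Rightarrow> 'i \<Rightarrow> complex" where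
  "weighted_act \<omega> w l a x i = (\<Sum>\<^sub>\<infinity>s. a s * (of_real (w (l s i) / (\<omega> s * w i)) * x (l s i)))"

definition fun_bimod :: "('s \<Rightarrow> real) \<Rightarrow> ('i \<Rightarrow> real) \<Rightarrow> ('i \<Rightarrow> 'j)
    \<Rightarrow> ('s \<Rightarrow> 'i \<Rightarrow> 'i) \<Rightarrow> ('s \<Rightarrow> 'i \<Rightarrow> 'i) \<Rightarrow> ('s, 'i \<Rightarrow> complex) bimod" where
  "fun_bimod \<omega> w \<pi> l r = \<lparr> vcarrier = fibre_c0 \<pi>, vzero = (\<lambda>_. 0), vadd = (\<lambda>x y i. x i + y i),
     vscal = (\<lambda>c x i. c * x i), vnorm = sup_norm,
     lact = weighted_act \<omega> w l, ract = (\<lambda>x a. weighted_act \<omega> w r a x) \<rparr>"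

lemma fun_bimod_simps:
  "vcarrier (fun_bimod \<omega> w \<pi> l r) = fibre_c0 \<pi>"
  "vzero (fun_bimod \<omega> w \<pi> l r) = (\<lambda>_. 0)"
  "vadd (fun_bimod \<omega> w \<pi> l r) = (\<lambda>x y i. x i + y i)"
  "vscal (fun_bimod \<omega> w \<pi> l r) = (\<lambda>c x i. c * x i)"
  "vnorm (fun_bimod \<omega> w \<pi> l r) = sup_norm"
  "lact (fun_bimod \<omega> w \<pi> l r) = weighted_act \<omega> w l"
  "ract (fun_bimod \<omega> w \<pi> l r) = (\<lambda>x a. weighted_act \<omega> w r a x)"
  "vsub (fun_bimod \<omega> w \<pi> l r) = (\<lambda>x y i. x i - y i)"
  by (simp_all add: fun_bimod_def vsub_def fun_eq_iff)

lemma sup_norm_eq_0_iff: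
  assumes "bounded (range x)"
  shows "sup_norm x = 0 \<longleftrightarrow> x = (\<lambda>_. 0)"
proof
  assume "sup_norm x = 0"
  then have "cmod (x i) \<le> 0" for i
    using sup_norm_upper[OF assms, of i] by simp
  then show "x = (\<lambda>_. 0)" by auto
next
  assume "x = (\<lambda>_. 0)"
  then show "sup_norm x = 0" by (simp add: sup_norm_def)
qed

lemma sup_norm_scale:
  assumes "bounded (range x)"
  shows "sup_norm (\<lambda>i. c * x i) = cmod c * sup_norm x"
proof (cases "c = 0")
  case True
  then show ?thesis by (simp add: sup_norm_def)
next
  case False
  have le: "sup_norm (\<lambda>i. d * y i) \<le> cmod d * sup_norm y" if "bounded (range y)" for d and y :: "'a \<Rightarrow> complex"
    by (rule sup_norm_least) (simp add: norm_mult mult_left_mono sup_norm_upper[OF that])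
  have "bounded (range (\<lambda>i. c * x i))"
    by (rule bounded_rangeI[of _ "cmod c * sup_norm x"]) (simp add: norm_mult mult_left_mono sup_norm_upper[OF assms])
  from le[OF this, of "1 / c"] have "sup_norm x \<le> sup_norm (\<lambda>i. c * x i) / cmod c"
    using False by (simp add: norm_divide)
  then have "cmod c * sup_norm x \<le> sup_norm (\<lambda>i. c * x i)"
    using False by (simp add: field_simps)
  with le[OF assms, of c] show ?thesis by linarith
qed

lemma fibre_c0_complete:
  fixes X :: "nat \<Rightarrow> 'i \<Rightarrow> complex"
  assumes X: "\<And>n. X n \<in> fibre_c0 \<pi>"
    and Cauchy: "\<And>e. e > 0 \<Longrightarrow> \<exists>N. \<forall>m\<ge>N. \<forall>n\<ge>N. sup_norm (\<lambda>i. X m i - X n i) < e"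
  shows "\<exists>x\<in>fibre_c0 \<pi>. (\<lambda>n. sup_norm (\<lambda>i. X n i - x i)) \<longlonglongrightarrow> 0"
proof -
  have diff: "(\<lambda>i. X m i - X n i) \<in> fibre_c0 \<pi>" for m n
    using fibre_c0_add[OF X[of m] fibre_c0_scale[OF X[of n], of "-1"]] by simp
  have pt: "\<exists>N. \<forall>m\<ge>N. \<forall>n\<ge>N. \<forall>i. cmod (X m i - X n i) < e" if "e > 0" for e
  proof -
    obtain N where N: "\<forall>m\<ge>N. \<forall>n\<ge>N. sup_norm (\<lambda>i. X m i - X n i) < e"
      using Cauchy[OF \<open>e > 0\<close>] by (elim exE)
    have "cmod (X m i - X n i) < e" if "m \<ge> N" "n \<ge> N" for m n i
      using fibre_c0_norm_le[OF diff[of m n], of i] N that by (meson le_less_trans)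
    then show ?thesis by auto
  qed
  have "Cauchy (\<lambda>n. X n i)" for i
  proof (rule CauchyI)
    fix e :: real assume "e > 0"
    from pt[OF this] show "\<exists>N. \<forall>m\<ge>N. \<forall>n\<ge>N. cmod (X m i - X n i) < e" by blast
  qed
  then obtain x where x: "\<And>i. (\<lambda>n. X n i) \<longlonglongrightarrow> x i"
    unfolding Cauchy_convergent_iff convergent_def by metis
  have unif: "\<exists>N. \<forall>n\<ge>N. \<forall>i. cmod (X n i - x i) \<le> e" if "e > 0" for e
  proof -
    obtain N where N: "\<And>m n i. m \<ge> N \<Longrightarrow> n \<ge> N \<Longrightarrow> cmod (X m i - X n i) < e"
      using pt[OF \<open>e > 0\<close>] by blast
    have "cmod (X n i - x i) \<le> e" if "n \<ge> N" for n i
    proof (rule LIMSEQ_le_const2)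
      show "(\<lambda>m. cmod (X n i - X m i)) \<longlonglongrightarrow> cmod (X n i - x i)"
        by (intro tendsto_intros x)
      show "\<exists>M. \<forall>m\<ge>M. cmod (X n i - X m i) \<le> e"
        using less_imp_le[OF N[OF \<open>n \<ge> N\<close>]] by auto
    qed
    then show ?thesis by blast
  qed
  have "x \<in> fibre_c0 \<pi>"
  proof (rule fibre_c0_uniform_limit)
    fix e :: real assume "e > 0"
    then obtain N where "\<forall>n\<ge>N. \<forall>i. cmod (X n i - x i) \<le> e"
      using unif[of e] by auto
    then have "\<forall>i. cmod (x i - X N i) \<le> e"
      by (simp add: norm_minus_commute)
    then show "\<exists>y\<in>fibre_c0 \<pi>. \<forall>i. cmod (x i - y i) \<le> e"
      using X by (rule bexI)
  qed
  moreover have "(\<lambda>n. sup_norm (\<lambda>i. X n i - x i)) \<longlonglongrightarrow> 0"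
  proof (rule LIMSEQ_I)
    fix e :: real assume "e > 0"
    then obtain N where N: "\<And>n i. n \<ge> N \<Longrightarrow> cmod (X n i - x i) \<le> e / 2"
      using unif[of "e / 2"] by auto
    have "norm (sup_norm (\<lambda>i. X n i - x i) - 0) < e" if "n \<ge> N" for n
      using sup_norm_least[of "\<lambda>i. X n i - x i", OF N[OF that]]
        sup_norm_nonneg[of "\<lambda>i. X n i - x i", OF bounded_rangeI[OF N[OF that]]] \<open>e > 0\<close> by simp
    then show "\<exists>N. \<forall>n\<ge>N. norm (sup_norm (\<lambda>i. X n i - x i) - 0) < e" by blast
  qed
  ultimately show ?thesis by blast
qed

lemma cbanach_fun_bimod:
  fixes \<pi> :: "'i \<Rightarrow> 'j"
  shows "cbanach (fun_bimod \<omega> w \<pi> l r)"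
proof -
  have nonneg: "0 \<le> sup_norm x" if "x \<in> fibre_c0 \<pi>" for x
    by (rule fibre_c0_sup_norm_nonneg[OF that])
  have zero_iff: "sup_norm x = 0 \<longleftrightarrow> x = (\<lambda>_. 0)" if "x \<in> fibre_c0 \<pi>" for x
    by (rule sup_norm_eq_0_iff[OF fibre_c0_bounded[OF that]])
  have scale: "sup_norm (\<lambda>i. c * x i) = cmod c * sup_norm x" if "x \<in> fibre_c0 \<pi>" for x c
    by (rule sup_norm_scale[OF fibre_c0_bounded[OF that]])
  have triangle: "sup_norm (\<lambda>i. x i + y i) \<le> sup_norm x + sup_norm y"
    if "x \<in> fibre_c0 \<pi>" "y \<in> fibre_c0 \<pi>" for x y
  proof (rule sup_norm_least)
    show "cmod (x i + y i) \<le> sup_norm x + sup_norm y" for i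
      using norm_triangle_ineq[of "x i" "y i"] fibre_c0_norm_le[OF that(1), of i] fibre_c0_norm_le[OF that(2), of i]
      by linarith
  qed
  have complete: "\<exists>x\<in>fibre_c0 \<pi>. (\<lambda>n. sup_norm (\<lambda>i. X n i - x i)) \<longlonglongrightarrow> 0"
    if "(\<forall>n. X n \<in> fibre_c0 \<pi>) \<and> (\<forall>e>0. \<exists>N. \<forall>m\<ge>N. \<forall>n\<ge>N. sup_norm (\<lambda>i. X m i - X n i) < e)"
    for X :: "nat \<Rightarrow> 'i \<Rightarrow> complex"
    by (rule fibre_c0_complete[OF conjunct1[OF that, rule_format] conjunct2[OF that, rule_format]])
  show ?thesis
    unfolding cbanach_def
    unfolding fun_bimod_simps
    apply (intro conjI allI ballI impI)
    apply (rule fibre_c0_zero)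
    apply (erule (1) fibre_c0_add)
    apply (erule fibre_c0_scale)
    apply (simp add: fun_eq_iff)
    apply (simp add: fun_eq_iff)
    apply (simp add: fun_eq_iff)
    apply (simp add: fun_eq_iff)
    apply (simp add: fun_eq_iff)
    apply (simp add: fun_eq_iff)
    apply (simp add: fun_eq_iff distrib_right)
    apply (simp add: fun_eq_iff distrib_left)
    apply (erule nonneg)
    apply (erule zero_iff)
    apply (erule (1) triangle)
    apply (erule scale)
    apply (erule complete)
    done
qed

text \<open>\<open>w_le\<close> makes the coefficients of the action at most 1. The last two
  conditions say that \<open>l s\<close> maps each fibre into a single fibre and is finite-to-one on
  it, which preserves vanishing at infinity along fibres.\<close>

locale weighted_action =
  fixes \<omega> :: "'s::semigroup_mult \<Rightarrow> real" and w :: "'i \<Rightarrow> real" and \<pi> :: "'i \<Rightarrow> 'j"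
    and l :: "'s \<Rightarrow> 'i \<Rightarrow> 'i"
  assumes weight: "weight \<omega>"
    and w_pos: "w i > 0"
    and w_le: "w (l s i) \<le> \<omega> s * w i"
    and fibre_cong: "\<pi> i = \<pi> i' \<Longrightarrow> \<pi> (l s i) = \<pi> (l s i')"
    and finite_preimage: "finite {i. \<pi> i = j \<and> l s i = i'}"
begin

lemma \<omega>_pos: "\<omega> s > 0"
  using weight by (simp add: weight_def)

lemma ratio_bounds: "0 \<le> w (l s i) / (\<omega> s * w i)" "w (l s i) / (\<omega> s * w i) \<le> 1"
  using w_le[of s i] w_pos[of i] w_pos[of "l s i"] \<omega>_pos[of s] by (simp_all add: less_imp_le)

lemma coeff_le:
  assumes "\<And>i. cmod (x i) \<le> B"
  shows "cmod (of_real (w (l s i) / (\<omega> s * w i)) * x (l s i)) \<le> B"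
proof -
  have "cmod (of_real (w (l s i) / (\<omega> s * w i)) * x (l s i)) \<le> 1 * cmod (x (l s i))"
    unfolding norm_mult norm_of_real using ratio_bounds[of s i] by (intro mult_right_mono) auto
  with assms[of "l s i"] show ?thesis by simp
qed

lemma act_summable:
  assumes "a \<in> l1" "bounded (range x)"
  shows "(\<lambda>s. a s * (of_real (w (l s i) / (\<omega> s * w i)) * x (l s i))) summable_on UNIV"
  by (rule l1_mult_summable[OF assms(1), where B = "sup_norm x"])
    (rule coeff_le[OF sup_norm_upper[OF assms(2)]])

lemma act_norm_le:
  assumes "a \<in> l1" "\<And>i. cmod (x i) \<le> B"
  shows "cmod (weighted_act \<omega> w l a x i) \<le> l1norm a * B"
  unfolding weighted_act_def
  by (rule l1_mult_norm_le[OF assms(1)]) (rule coeff_le[OF assms(2)])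

lemma act_add_left:
  assumes "a \<in> l1" "b \<in> l1" "bounded (range x)"
  shows "weighted_act \<omega> w l (\<lambda>s. a s + b s) x = (\<lambda>i. weighted_act \<omega> w l a x i + weighted_act \<omega> w l b x i)"
  unfolding weighted_act_def distrib_right
  by (intro ext infsum_add act_summable assms)

lemma act_add_right:
  assumes "a \<in> l1" "bounded (range x)" "bounded (range y)"
  shows "weighted_act \<omega> w l a (\<lambda>i. x i + y i) = (\<lambda>i. weighted_act \<omega> w l a x i + weighted_act \<omega> w l a y i)"
  unfolding weighted_act_def distrib_left
  by (intro ext infsum_add act_summable assms)

lemma act_scale_left: "weighted_act \<omega> w l (cscale c a) x = (\<lambda>i. c * weighted_act \<omega> w l a x i)"
  unfolding weighted_act_def cscale_def by (simp add: infsum_cmult_right'[symmetric] mult_ac)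

lemma act_scale_right: "weighted_act \<omega> w l a (\<lambda>i. c * x i) = (\<lambda>i. c * weighted_act \<omega> w l a x i)"
  unfolding weighted_act_def by (simp add: infsum_cmult_right'[symmetric] mult_ac)

lemma act_delta: "weighted_act \<omega> w l (delta s) x i = of_real (w (l s i) / (\<omega> s * w i)) * x (l s i)"
  unfolding weighted_act_def by (rule sum_delta)

lemma fibre_c0_act_delta:
  assumes x: "x \<in> fibre_c0 \<pi>"
  shows "(\<lambda>i. of_real (w (l s i) / (\<omega> s * w i)) * x (l s i)) \<in> fibre_c0 \<pi>"
  unfolding fibre_c0_def mem_Collect_eq
proof (intro conjI allI impI)
  let ?y = "\<lambda>i. of_real (w (l s i) / (\<omega> s * w i)) * x (l s i)"
  show "bounded (range ?y)"
    by (rule bounded_rangeI, rule coeff_le, rule fibre_c0_norm_le[OF x])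
  fix j and e :: real assume e: "e > 0"
  show "finite {i. \<pi> i = j \<and> e \<le> cmod (?y i)}"
  \<comment> \<open>A point \<open>i0\<close> of the fibre over \<open>j\<close> is used to name the
    fibre into which \<open>l s\<close> maps it; an empty fibre has no such point.\<close>
  proof (cases "\<exists>i0. \<pi> i0 = j")
    case False
    then show ?thesis
      by (intro finite_subset[OF _ finite.emptyI]) blast
  next
    case True
    then obtain i0 where i0: "\<pi> i0 = j" by blast
    let ?F = "{i. \<pi> i = \<pi> (l s i0) \<and> e \<le> cmod (x i)}"
    have "finite (l s -` ?F \<inter> {i. \<pi> i = j})"
    proof (rule finite_finite_vimage_IntI)
      show "finite ?F" by (rule fibre_c0_finite[OF x e])
      have "l s -` {i'} \<inter> {i. \<pi> i = j} = {i. \<pi> i = j \<and> l s i = i'}" for i' by auto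
      then show "finite (l s -` {i'} \<inter> {i. \<pi> i = j})" for i'
        by (simp add: finite_preimage)
    qed
    moreover have "{i. \<pi> i = j \<and> e \<le> cmod (?y i)} \<subseteq> l s -` ?F \<inter> {i. \<pi> i = j}"
    proof
      fix i assume i: "i \<in> {i. \<pi> i = j \<and> e \<le> cmod (?y i)}"
      have "\<bar>w (l s i) / (\<omega> s * w i)\<bar> \<le> 1"
        using ratio_bounds[of s i] by simp
      then have "cmod (?y i) \<le> 1 * cmod (x (l s i))"
        unfolding norm_mult norm_of_real by (rule mult_right_mono) simp
      with i have "e \<le> cmod (x (l s i))" by simp
      moreover have "\<pi> (l s i) = \<pi> (l s i0)"
        using i i0 by (intro fibre_cong) simp
      ultimately show "i \<in> l s -` ?F \<inter> {i. \<pi> i = j}"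
        using i by simp
    qed
    ultimately show ?thesis by (rule rev_finite_subset)
  qed
qed

text \<open>The action of \<open>a\<close> is a uniform limit of finite combinations of translates:
  dropping a tail with \<open>l1norm\<close> below \<open>e / B\<close> changes each value by at
  most \<open>e\<close>.\<close>

lemma fibre_c0_act:
  assumes a: "a \<in> l1" and x: "x \<in> fibre_c0 \<pi>"
  shows "weighted_act \<omega> w l a x \<in> fibre_c0 \<pi>"
proof (rule fibre_c0_uniform_limit)
  fix e :: real assume e: "e > 0"
  \<comment> \<open>Adding 1 keeps the bound positive even for \<open>x = 0\<close>, so that
    \<open>e / B\<close> makes sense.\<close>
  define B where "B = sup_norm x + 1"
  have xB: "cmod (x i) \<le> B" for i
    using fibre_c0_norm_le[OF x, of i] by (simp add: B_def)
  have B: "B > 0"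
    using fibre_c0_sup_norm_nonneg[OF x] by (simp add: B_def)
  have "((\<lambda>s. norm (a s)) has_sum l1norm a) UNIV"
    unfolding l1norm_def by (rule has_sum_infsum[OF l1_abs_summable[OF a]])
  then have "(sum (\<lambda>s. norm (a s)) \<longlongrightarrow> l1norm a) (finite_subsets_at_top UNIV)"
    by (simp add: has_sum_def)
  moreover have "e / B > 0" using e B by simp
  ultimately have "\<forall>\<^sub>F A in finite_subsets_at_top UNIV. dist (sum (\<lambda>s. norm (a s)) A) (l1norm a) < e / B"
    by (rule tendstoD)
  then obtain A where A: "finite A" "dist (sum (\<lambda>s. norm (a s)) A) (l1norm a) < e / B"
    unfolding eventually_finite_subsets_at_top by blast
  define tail where "tail = (\<lambda>s. if s \<in> A then 0 else a s)"
  have fin: "(\<lambda>s. norm (a s)) summable_on A" "(\<lambda>s. norm (a s)) summable_on - A"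
    using A(1) summable_on_subset_banach[OF l1_abs_summable[OF a]] by auto
  have tail_sum: "(\<lambda>s. norm (tail s)) summable_on UNIV" "l1norm tail = l1norm a - sum (\<lambda>s. norm (a s)) A"
  proof -
    show "(\<lambda>s. norm (tail s)) summable_on UNIV"
      by (rule summable_on_comparison_test[OF l1_abs_summable[OF a]]) (auto simp: tail_def)
    have "l1norm a = infsum (\<lambda>s. norm (a s)) A + infsum (\<lambda>s. norm (a s)) (- A)"
      unfolding l1norm_def using infsum_Un_disjoint[OF fin] by simp
    moreover have "infsum (\<lambda>s. norm (a s)) (- A) = l1norm tail"
      unfolding l1norm_def by (rule infsum_cong_neutral) (auto simp: tail_def)
    ultimately show "l1norm tail = l1norm a - sum (\<lambda>s. norm (a s)) A"
      using A(1) by simp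
  qed
  have tail: "tail \<in> l1" using tail_sum(1) by (simp add: l1_def)
  let ?t = "\<lambda>s i. of_real (w (l s i) / (\<omega> s * w i)) * x (l s i)"
  let ?y = "\<lambda>i. \<Sum>s\<in>A. a s * ?t s i"
  have y: "?y \<in> fibre_c0 \<pi>"
    by (intro fibre_c0_sum fibre_c0_scale fibre_c0_act_delta x)
  have "weighted_act \<omega> w l a x i - ?y i = weighted_act \<omega> w l tail x i" for i
  proof -
    have s: "(\<lambda>s. a s * ?t s i) summable_on UNIV"
      by (rule act_summable[OF a fibre_c0_bounded[OF x]])
    have "weighted_act \<omega> w l a x i = infsum (\<lambda>s. a s * ?t s i) A + infsum (\<lambda>s. a s * ?t s i) (- A)"
      unfolding weighted_act_def
      using infsum_Un_disjoint[of "\<lambda>s. a s * ?t s i" A "- A"] A(1) summable_on_subset_banach[OF s, of "- A"] by simp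
    moreover have "infsum (\<lambda>s. a s * ?t s i) (- A) = weighted_act \<omega> w l tail x i"
      unfolding weighted_act_def by (rule infsum_cong_neutral) (auto simp: tail_def)
    ultimately show ?thesis using A(1) by simp
  qed
  moreover have "cmod (weighted_act \<omega> w l tail x i) \<le> e" for i
  proof -
    have "cmod (weighted_act \<omega> w l tail x i) \<le> l1norm tail * B"
      by (rule act_norm_le[OF tail xB])
    also have "\<dots> \<le> e / B * B"
      using A(2) B unfolding tail_sum(2) by (intro mult_right_mono) (auto simp: dist_real_def)
    finally show ?thesis using B by simp
  qed
  ultimately show "\<exists>y\<in>fibre_c0 \<pi>. \<forall>i. cmod (weighted_act \<omega> w l a x i - y i) \<le> e"
    using y by (intro bexI[of _ ?y]) auto
qed

end

section \<open>Composition of weighted actions and the bimodule laws\<close>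

lemma weighted_act_iterate:
  fixes \<omega> :: "'s::semigroup_mult \<Rightarrow> real" and w :: "'i \<Rightarrow> real" and \<pi> :: "'i \<Rightarrow> 'j"
  assumes l: "weighted_action \<omega> w \<pi> l" and r: "weighted_action \<omega> w \<pi> r"
  shows "weighted_act \<omega> w l a (weighted_act \<omega> w r b x) i
    = (\<Sum>\<^sub>\<infinity>s. a s * (\<Sum>\<^sub>\<infinity>t. b t * (of_real (w (r t (l s i)) / (\<omega> s * \<omega> t * w i)) * x (r t (l s i)))))"
  unfolding weighted_act_def infsum_cmult_right'[symmetric]
proof (intro infsum_cong)
  interpret l: weighted_action \<omega> w \<pi> l by (rule l)
  have merge: "c * (of_real p * (d * (of_real q * y))) = c * (d * (of_real u * y))" if "p * q = u"
    for p q u and c d y :: complex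
    unfolding that[symmetric] by simp
  fix s t
  \<comment> \<open>The intermediate weight \<open>w (l s i)\<close> cancels, so only the weights at
    the two ends remain.\<close>
  have "w (l s i) / (\<omega> s * w i) * (w (r t (l s i)) / (\<omega> t * w (l s i))) = w (r t (l s i)) / (\<omega> s * \<omega> t * w i)"
    using l.w_pos[of "l s i"] by simp
  from merge[OF this] show "a s * (of_real (w (l s i) / (\<omega> s * w i)) * (b t * (of_real (w (r t (l s i)) / (\<omega> t * w (l s i))) * x (r t (l s i)))))
      = a s * (b t * (of_real (w (r t (l s i)) / (\<omega> s * \<omega> t * w i)) * x (r t (l s i))))" .
qed

lemma weighted_act_iterate_bound:
  fixes \<omega> :: "'s::semigroup_mult \<Rightarrow> real" and w :: "'i \<Rightarrow> real" and \<pi> :: "'i \<Rightarrow> 'j"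
  assumes l: "weighted_action \<omega> w \<pi> l" and r: "weighted_action \<omega> w \<pi> r" and x: "bounded (range x)"
  shows "cmod (of_real (w (r t (l s i)) / (\<omega> s * \<omega> t * w i)) * x (r t (l s i))) \<le> sup_norm x"
proof -
  interpret l: weighted_action \<omega> w \<pi> l by (rule l)
  interpret r: weighted_action \<omega> w \<pi> r by (rule r)
  have "w (r t (l s i)) / (\<omega> s * \<omega> t * w i) = w (l s i) / (\<omega> s * w i) * (w (r t (l s i)) / (\<omega> t * w (l s i)))"
    using l.w_pos[of "l s i"] by simp
  also have "\<bar>\<dots>\<bar> \<le> 1"
    using mult_mono[OF l.ratio_bounds(2)[of s i] r.ratio_bounds(2)[of t "l s i"]]
      l.ratio_bounds(1)[of s i] r.ratio_bounds(1)[of t "l s i"] by (simp only: abs_mult abs_of_nonneg) simp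
  finally have "\<bar>w (r t (l s i)) / (\<omega> s * \<omega> t * w i)\<bar> * cmod (x (r t (l s i))) \<le> 1 * sup_norm x"
    by (intro mult_mono sup_norm_upper[OF x]) auto
  then show ?thesis by (simp only: norm_mult norm_of_real mult_1)
qed

text \<open>For commuting translations both composites are the same absolutely convergent double
  sum, taken in different orders.\<close>

lemma weighted_act_commute:
  fixes \<omega> :: "'s::semigroup_mult \<Rightarrow> real" and w :: "'i \<Rightarrow> real" and \<pi> :: "'i \<Rightarrow> 'j"
  assumes l: "weighted_action \<omega> w \<pi> l" and r: "weighted_action \<omega> w \<pi> r"
    and comm: "\<And>s t i. l s (r t i) = r t (l s i)"
    and "a \<in> l1" "b \<in> l1" "bounded (range x)"
  shows "weighted_act \<omega> w r b (weighted_act \<omega> w l a x) = weighted_act \<omega> w l a (weighted_act \<omega> w r b x)"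
proof
  fix i
  have "weighted_act \<omega> w l a (weighted_act \<omega> w r b x) i
      = (\<Sum>\<^sub>\<infinity>t. b t * (\<Sum>\<^sub>\<infinity>s. a s * (of_real (w (r t (l s i)) / (\<omega> s * \<omega> t * w i)) * x (r t (l s i)))))"
    unfolding weighted_act_iterate[OF l r]
    by (rule l1_iterated_sum_swap[OF assms(4,5)]) (rule weighted_act_iterate_bound[OF l r assms(6)])
  then show "weighted_act \<omega> w r b (weighted_act \<omega> w l a x) i = weighted_act \<omega> w l a (weighted_act \<omega> w r b x) i"
    unfolding weighted_act_iterate[OF r l] comm by (simp only: mult.commute[of "\<omega> _" "\<omega> _"])
qed

text \<open>The factor \<open>Omega \<omega> s t\<close> replaces \<open>\<omega> (s * t)\<close> by
  \<open>\<omega> s * \<omega> t\<close> in the denominator, which is the coefficient of two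
  successive actions.\<close>

lemma weighted_act_conv:
  fixes \<omega> :: "'s::semigroup_mult \<Rightarrow> real" and w :: "'i \<Rightarrow> real" and \<pi> :: "'i \<Rightarrow> 'j"
  assumes l: "weighted_action \<omega> w \<pi> l" and a: "a \<in> l1" and b: "b \<in> l1" and x: "bounded (range x)"
  shows "weighted_act \<omega> w l (conv \<omega> a b) x i
    = (\<Sum>\<^sub>\<infinity>s. a s * (\<Sum>\<^sub>\<infinity>t. b t * (of_real (w (l (s * t) i) / (\<omega> s * \<omega> t * w i)) * x (l (s * t) i))))"
proof -
  interpret l: weighted_action \<omega> w \<pi> l by (rule l)
  have *: "of_real (Omega \<omega> s t) * (of_real (w (l (s * t) i) / (\<omega> (s * t) * w i)) * x (l (s * t) i))
      = of_real (w (l (s * t) i) / (\<omega> s * \<omega> t * w i)) * x (l (s * t) i)" for s t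
  proof -
    have "Omega \<omega> s t * (w (l (s * t) i) / (\<omega> (s * t) * w i)) = w (l (s * t) i) / (\<omega> s * \<omega> t * w i)"
      using l.\<omega>_pos[of "s * t"] by (simp add: Omega_def)
    then show ?thesis
      by (simp only: of_real_mult[symmetric] mult.assoc[symmetric])
  qed
  have "weighted_act \<omega> w l (conv \<omega> a b) x i = (\<Sum>\<^sub>\<infinity>s. a s * (\<Sum>\<^sub>\<infinity>t. b t *
      (of_real (Omega \<omega> s t) * (of_real (w (l (s * t) i) / (\<omega> (s * t) * w i)) * x (l (s * t) i)))))"
    unfolding weighted_act_def
    by (rule conv_sum[OF l.weight a b]) (rule l.coeff_le[OF sup_norm_upper[OF x]])
  then show ?thesis by (simp only: *)
qed

text \<open>On indices \<open>l\<close> is a right action and \<open>r\<close> a left action of the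
  semigroup; composition with them reverses the sides and makes the functions a left and a right
  module.\<close>

theorem banach_bimod_fun_bimod:
  fixes \<omega> :: "'s::semigroup_mult \<Rightarrow> real" and w :: "'i \<Rightarrow> real" and \<pi> :: "'i \<Rightarrow> 'j"
  assumes l: "weighted_action \<omega> w \<pi> l" and r: "weighted_action \<omega> w \<pi> r"
    and l_mult: "\<And>s t i. l (s * t) i = l t (l s i)" and r_mult: "\<And>s t i. r (s * t) i = r s (r t i)"
    and comm: "\<And>s t i. l s (r t i) = r t (l s i)"
  shows "banach_bimod \<omega> (fun_bimod \<omega> w \<pi> l r)"
proof -
  interpret l: weighted_action \<omega> w \<pi> l by (rule l)
  interpret r: weighted_action \<omega> w \<pi> r by (rule r)
  have l_assoc: "weighted_act \<omega> w l (conv \<omega> a b) x = weighted_act \<omega> w l a (weighted_act \<omega> w l b x)"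
    if "a \<in> l1" "b \<in> l1" "x \<in> fibre_c0 \<pi>" for a b x
    by (rule ext) (simp only: weighted_act_conv[OF l that(1,2) fibre_c0_bounded[OF that(3)]] weighted_act_iterate[OF l l] l_mult)
  \<comment> \<open>Unlike in \<open>l_assoc\<close>, the nested sums on the two sides come in
    opposite orders and have to be exchanged.\<close>
  have r_assoc: "weighted_act \<omega> w r (conv \<omega> a b) x = weighted_act \<omega> w r b (weighted_act \<omega> w r a x)"
    if "a \<in> l1" "b \<in> l1" "x \<in> fibre_c0 \<pi>" for a b x
  proof
    fix i
    have bound: "cmod (of_real (w (r s (r t i)) / (\<omega> s * \<omega> t * w i)) * x (r s (r t i))) \<le> sup_norm x" for s t
      using weighted_act_iterate_bound[OF r r fibre_c0_bounded[OF that(3)], of s t i]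
      by (simp only: mult.commute[of "\<omega> _" "\<omega> _"])
    show "weighted_act \<omega> w r (conv \<omega> a b) x i = weighted_act \<omega> w r b (weighted_act \<omega> w r a x) i"
      unfolding weighted_act_conv[OF r that(1,2) fibre_c0_bounded[OF that(3)]] weighted_act_iterate[OF r r] r_mult
      by (subst l1_iterated_sum_swap[OF that(1,2) bound]) (simp only: mult.commute[of "\<omega> _" "\<omega> _"])
  qed
  have norm_le: "sup_norm (weighted_act \<omega> w l a x) \<le> 1 * l1norm a * sup_norm x"
      "sup_norm (weighted_act \<omega> w r a x) \<le> 1 * l1norm a * sup_norm x"
    if "a \<in> l1" "x \<in> fibre_c0 \<pi>" for a x
    using sup_norm_least[OF l.act_norm_le[OF that(1) fibre_c0_norm_le[OF that(2)]]]
      sup_norm_least[OF r.act_norm_le[OF that(1) fibre_c0_norm_le[OF that(2)]]] by simp_all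
  show ?thesis
    unfolding banach_bimod_def fun_bimod_simps
    apply (intro conjI ballI allI)
    apply (rule cbanach_fun_bimod)
    apply (erule (1) l.fibre_c0_act)
    apply (erule (1) r.fibre_c0_act)
    apply (erule (1) l.act_add_left, erule fibre_c0_bounded)
    apply (erule (1) r.act_add_left, erule fibre_c0_bounded)
    apply (rule l.act_scale_left)
    apply (rule r.act_scale_left)
    apply (rule l.act_scale_right)
    apply (rule r.act_scale_right)
    apply (erule l.act_add_right, erule fibre_c0_bounded, erule fibre_c0_bounded)
    apply (erule r.act_add_right, erule fibre_c0_bounded, erule fibre_c0_bounded)
    apply (erule (2) l_assoc)
    apply (erule (2) r_assoc)
    apply (erule (1) weighted_act_commute[OF l r comm], erule fibre_c0_bounded)
    by (intro exI[of _ 1] ballI conjI norm_le)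
qed

section \<open>Transport of bimodules along injections\<close>

text \<open>\<open>bi_injective\<close> quantifies only over bimodules with carriers in two fixed
  types. An injection \<open>J\<close> moves a bimodule from its natural function type into such a
  type, with \<open>inv J\<close> as decoder.\<close>

definition transport :: "('v \<Rightarrow> 'w) \<Rightarrow> ('s, 'v) bimod \<Rightarrow> ('s, 'w) bimod" where
  "transport J M = \<lparr> vcarrier = J ` vcarrier M, vzero = J (vzero M),
     vadd = (\<lambda>x y. J (vadd M (inv J x) (inv J y))), vscal = (\<lambda>c x. J (vscal M c (inv J x))),
     vnorm = (\<lambda>x. vnorm M (inv J x)),
     lact = (\<lambda>a x. J (lact M a (inv J x))), ract = (\<lambda>x a. J (ract M (inv J x) a)) \<rparr>"

context
  fixes J :: "'v \<Rightarrow> 'w"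
  assumes inj: "inj J"
begin

lemma transport_simps:
  "vcarrier (transport J M) = J ` vcarrier M"
  "vzero (transport J M) = J (vzero M)"
  "vadd (transport J M) (J x) (J y) = J (vadd M x y)"
  "vscal (transport J M) c (J x) = J (vscal M c x)"
  "vnorm (transport J M) (J x) = vnorm M x"
  "lact (transport J M) a (J x) = J (lact M a x)"
  "ract (transport J M) (J x) a = J (ract M x a)"
  "vsub (transport J M) (J x) (J y) = J (vsub M x y)"
  by (simp_all add: transport_def vsub_def inv_f_f[OF inj])

lemma transport_seq:
  assumes "\<And>n. X n \<in> J ` A"
  obtains Y where "X = (\<lambda>n. J (Y n))" "\<And>n. Y n \<in> A"
proof
  show "X = (\<lambda>n. J (inv J (X n)))"
  proof
    show "X n = J (inv J (X n))" for n using assms[of n] by (auto simp: inv_f_f[OF inj])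
  qed
  show "inv J (X n) \<in> A" for n
    using assms[of n] by (auto simp: inv_f_f[OF inj])
qed

lemma cbanach_transport:
  assumes "cbanach M"
  shows "cbanach (transport J M)"
proof -
  have complete: "\<exists>x\<in>J ` vcarrier M. (\<lambda>n. vnorm (transport J M) (vsub (transport J M) (X n) x)) \<longlonglongrightarrow> 0"
    if X: "(\<forall>n. X n \<in> J ` vcarrier M) \<and>
      (\<forall>e>0. \<exists>N. \<forall>m\<ge>N. \<forall>n\<ge>N. vnorm (transport J M) (vsub (transport J M) (X m) (X n)) < e)" for X :: "nat \<Rightarrow> 'w"
  proof -
    from X obtain Y where Y: "X = (\<lambda>n. J (Y n))" "\<And>n. Y n \<in> vcarrier M"
      using transport_seq[of X "vcarrier M"] by metis
    have "\<forall>Y::nat \<Rightarrow> 'v. (\<forall>n. Y n \<in> vcarrier M) \<and>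
        (\<forall>e>0. \<exists>N. \<forall>m\<ge>N. \<forall>n\<ge>N. vnorm M (vsub M (Y m) (Y n)) < e)
        \<longrightarrow> (\<exists>x\<in>vcarrier M. (\<lambda>n. vnorm M (vsub M (Y n) x)) \<longlonglongrightarrow> 0)"
      using assms unfolding cbanach_def by (elim conjE) assumption
    from this[rule_format, of Y] obtain y where "y \<in> vcarrier M" "(\<lambda>n. vnorm M (vsub M (Y n) y)) \<longlonglongrightarrow> 0"
      using X Y(2) unfolding Y(1) transport_simps by auto
    then show ?thesis
      unfolding Y(1) by (intro bexI[of _ "J y"]) (simp_all add: transport_simps)
  qed
  have inj_iff: "J x = J y \<longleftrightarrow> x = y" for x y
    using inj by (auto simp: inj_def)
  from assms show ?thesis
    unfolding cbanach_def
    apply (elim conjE)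
    apply (intro conjI)
                  \<comment> \<open>The fifteenth conjunct is completeness: it quantifies over
                    sequences, which have to be decoded first, while the other conjuncts follow by
                    rewriting.\<close>
                  prefer 15
                  subgoal using complete by (simp only: transport_simps) blast
    apply (simp_all add: transport_simps inj_iff)
    done
qed

lemma banach_bimod_transport:
  assumes "banach_bimod \<omega> M"
  shows "banach_bimod \<omega> (transport J M)"
proof -
  have "cbanach (transport J M)"
    using assms by (intro cbanach_transport) (simp add: banach_bimod_def)
  with assms show ?thesis
    unfolding banach_bimod_def by (simp add: transport_simps)
qed

end

lemma bounded_clinear_on_transport:
  assumes J: "inj J" and K: "inj K" and T: "bounded_clinear_on M N T"
  shows "bounded_clinear_on (transport J M) (transport K N) (\<lambda>x. K (T (inv J x)))"
  using T unfolding bounded_clinear_on_def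
  by (simp add: transport_simps[OF J] transport_simps[OF K] inv_f_f[OF J])

lemma bimod_hom_transport:
  assumes J: "inj J" and K: "inj K" and T: "bimod_hom M N T"
  shows "bimod_hom (transport J M) (transport K N) (\<lambda>x. K (T (inv J x)))"
  using T bounded_clinear_on_transport[OF J K, of M N T] unfolding bimod_hom_def
  by (simp add: transport_simps[OF J] transport_simps[OF K] inv_f_f[OF J])

lemma bimod_hom_transport_source:
  assumes J: "inj J" and T: "bimod_hom M N T"
  shows "bimod_hom (transport J M) N (\<lambda>x. T (inv J x))"
  using T unfolding bimod_hom_def bounded_clinear_on_def
  by (simp add: transport_simps[OF J] inv_f_f[OF J])

lemma bimod_hom_untransport_source:
  assumes J: "inj J" and T: "bimod_hom (transport J M) N T"
  shows "bimod_hom M N (\<lambda>x. T (J x))"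
  using T unfolding bimod_hom_def bounded_clinear_on_def
  by (simp add: transport_simps[OF J])

lemma closed_in_bimod_transport:
  assumes J: "inj J" and W: "W \<subseteq> vcarrier M" and cl: "closed_in_bimod M W"
  shows "closed_in_bimod (transport J M) (J ` W)"
  unfolding closed_in_bimod_def
proof (intro allI impI, elim conjE)
  fix X y assume X: "\<forall>n. X n \<in> J ` W" and y: "y \<in> vcarrier (transport J M)"
    and lim: "(\<lambda>n. vnorm (transport J M) (vsub (transport J M) (X n) y)) \<longlonglongrightarrow> 0"
  obtain Y where Y: "X = (\<lambda>n. J (Y n))" "\<And>n. Y n \<in> W"
    using transport_seq[OF J] X by metis
  obtain z where z: "y = J z" "z \<in> vcarrier M"
    using y by (auto simp: transport_simps[OF J])
  have "(\<lambda>n. vnorm M (vsub M (Y n) z)) \<longlonglongrightarrow> 0"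
    using lim unfolding Y(1) z(1) transport_simps[OF J] .
  then have "z \<in> W"
    using cl Y(2) z(2) unfolding closed_in_bimod_def by blast
  then show "y \<in> J ` W" using z by blast
qed

lemma complemented_in_transport:
  assumes J: "inj J" and W: "complemented_in M W"
  shows "complemented_in (transport J M) (J ` W)"
proof -
  obtain P where P: "bounded_clinear_on M M P" "\<forall>x\<in>vcarrier M. P (P x) = P x" "P ` vcarrier M = W"
    using W unfolding complemented_in_def by blast
  show ?thesis
    unfolding complemented_in_def
  proof (intro exI conjI)
    show "bounded_clinear_on (transport J M) (transport J M) (\<lambda>x. J (P (inv J x)))"
      by (rule bounded_clinear_on_transport[OF J J P(1)])
    show "\<forall>x\<in>vcarrier (transport J M). J (P (inv J (J (P (inv J x))))) = J (P (inv J x))"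
      using P(2) by (simp add: transport_simps[OF J] inv_f_f[OF J])
    show "(\<lambda>x. J (P (inv J x))) ` vcarrier (transport J M) = J ` W"
      unfolding P(3)[symmetric] by (simp add: transport_simps[OF J] inv_f_f[OF J] image_image)
  qed
qed

text \<open>This makes the extension property available for carrier types that merely embed into the
  test types: the whole diagram is transported, and the extension found there is precomposed with
  \<open>K\<close>.\<close>

lemma bi_injective_extend:
  fixes F :: "('s::semigroup_mult, 'v) bimod" and G :: "('s, 'w) bimod"
    and J :: "'v \<Rightarrow> 'f" and K :: "'w \<Rightarrow> 'g"
  assumes inj: "bi_injective TYPE('f) TYPE('g) \<omega> E" and J: "inj J" and K: "inj K"
    and F: "banach_bimod \<omega> F" and G: "banach_bimod \<omega> G" and \<theta>: "bimod_hom F G \<theta>"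
    and inj_\<theta>: "inj_on \<theta> (vcarrier F)" and cl: "closed_in_bimod G (\<theta> ` vcarrier F)"
    and co: "complemented_in G (\<theta> ` vcarrier F)" and \<sigma>: "bimod_hom F E \<sigma>"
  obtains \<rho> where "bimod_hom G E \<rho>" "\<And>x. x \<in> vcarrier F \<Longrightarrow> \<rho> (\<theta> x) = \<sigma> x"
proof -
  let ?F = "transport J F" and ?G = "transport K G" and ?\<theta> = "\<lambda>x. K (\<theta> (inv J x))"
  have img: "?\<theta> ` vcarrier ?F = K ` (\<theta> ` vcarrier F)"
    by (simp add: transport_simps[OF J] inv_f_f[OF J] image_image)
  have sub: "\<theta> ` vcarrier F \<subseteq> vcarrier G"
    using \<theta> unfolding bimod_hom_def bounded_clinear_on_def by blast
  have "inj_on ?\<theta> (vcarrier ?F)"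
    using inj_\<theta> K unfolding transport_simps[OF J]
    by (auto simp: inj_on_def inv_f_f[OF J])
  moreover have "closed_in_bimod ?G (?\<theta> ` vcarrier ?F)"
    unfolding img by (rule closed_in_bimod_transport[OF K sub cl])
  moreover have "complemented_in ?G (?\<theta> ` vcarrier ?F)"
    unfolding img by (rule complemented_in_transport[OF K co])
  ultimately have "\<exists>\<rho>. bimod_hom ?G E \<rho> \<and> (\<forall>x\<in>vcarrier ?F. \<rho> (?\<theta> x) = \<sigma> (inv J x))"
    using inj[unfolded bi_injective_def, rule_format, of ?F ?G ?\<theta> "\<lambda>x. \<sigma> (inv J x)"]
      banach_bimod_transport[OF J F] banach_bimod_transport[OF K G] bimod_hom_transport[OF J K \<theta>]
      bimod_hom_transport_source[OF J \<sigma>] by blast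
  then obtain \<rho> where \<rho>: "bimod_hom ?G E \<rho>" "\<And>x. x \<in> vcarrier ?F \<Longrightarrow> \<rho> (?\<theta> x) = \<sigma> (inv J x)"
    by blast
  show thesis
  proof (rule that)
    show "bimod_hom G E (\<lambda>x. \<rho> (K x))"
      by (rule bimod_hom_untransport_source[OF K \<rho>(1)])
    show "\<rho> (K (\<theta> x)) = \<sigma> x" if "x \<in> vcarrier F" for x
      using \<rho>(2)[of "J x"] that by (simp add: transport_simps[OF J] inv_f_f[OF J])
  qed
qed

section \<open>Encoding complex functions as sets of sets over an infinite semigroup\<close>

lemma inj_complex_nat_set: "\<exists>c :: complex \<Rightarrow> nat set. inj c"
proof -
  \<comment> \<open>Dedekind cuts, with rationals coded by naturals; density of the rationals
    separates distinct reals.\<close>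
  define cut where "cut x = {n. of_rat (from_nat n) < x}" for x :: real
  have cut_le: "x \<le> y" if "cut x \<subseteq> cut y" for x y
  proof (rule ccontr)
    assume "\<not> x \<le> y"
    then obtain q where q: "y < of_rat q" "of_rat q < x"
      using of_rat_dense[of y x] by auto
    then have "to_nat q \<in> cut x" "to_nat q \<notin> cut y"
      by (simp_all add: cut_def)
    with that show False by blast
  qed
  have "inj cut"
    by (rule injI) (simp add: cut_le antisym)
  \<comment> \<open>Two sets of naturals merge into one: even numbers record the first and odd
    numbers the second.\<close>
  moreover have "inj (\<lambda>(A, B). (\<lambda>n. 2 * n) ` A \<union> (\<lambda>n. 2 * n + 1) ` B :: nat set)"
  proof (rule injI, clarify)
    fix A B A' B' :: "nat set"
    assume eq: "(\<lambda>n. 2 * n) ` A \<union> (\<lambda>n. 2 * n + 1) ` B = (\<lambda>n. 2 * n) ` A' \<union> (\<lambda>n. 2 * n + 1) ` B'"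
    have neq: "2 * n \<noteq> Suc (2 * m)" "Suc (2 * m) \<noteq> 2 * n" for n m :: nat by presburger+
    have even: "2 * n \<in> (\<lambda>n. 2 * n) ` A \<union> (\<lambda>n. 2 * n + 1) ` B \<longleftrightarrow> n \<in> A" for n and A B :: "nat set"
      by (auto simp: neq)
    have odd: "2 * n + 1 \<in> (\<lambda>n. 2 * n) ` A \<union> (\<lambda>n. 2 * n + 1) ` B \<longleftrightarrow> n \<in> B" for n and A B :: "nat set"
      by (auto simp: neq)
    show "A = A' \<and> B = B'"
    proof (intro conjI set_eqI)
      show "n \<in> A \<longleftrightarrow> n \<in> A'" for n using even[of n A B] even[of n A' B'] unfolding eq by simp
      show "n \<in> B \<longleftrightarrow> n \<in> B'" for n using odd[of n A B] odd[of n A' B'] unfolding eq by simp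
    qed
  qed
  ultimately have "inj ((\<lambda>(A, B). (\<lambda>n. 2 * n) ` A \<union> (\<lambda>n. 2 * n + 1) ` B) \<circ> (\<lambda>z. (cut (Re z), cut (Im z))))"
    by (intro inj_compose injI) (simp_all add: inj_eq complex_eq_iff)
  then show ?thesis by blast
qed

text \<open>An infinite set absorbs its own square. The values \<open>e 0\<close> and
  \<open>e 1\<close> serve as tags that keep \<open>None\<close> apart from
  \<open>Some\<close>.\<close>

lemma inj_option_times_nat:
  assumes "infinite (UNIV :: 's set)"
  shows "\<exists>f :: ('s option \<times> 's) \<times> nat \<Rightarrow> 's. inj f"
proof -
  obtain p :: "'s \<times> 's \<Rightarrow> 's" where p: "inj p"
    using card_of_Times_same_infinite[OF assms]
    unfolding card_of_ordIso[symmetric] by (auto simp: bij_betw_def)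
  obtain e :: "nat \<Rightarrow> 's" where e: "inj e"
    using assms infinite_countable_subset by blast
  define g where "g a = (case a of None \<Rightarrow> p (e 0, e 0) | Some s \<Rightarrow> p (e 1, s))" for a
  have g: "inj g"
    by (rule injI) (simp add: g_def inj_eq[OF p] inj_eq[OF e] split: option.splits)
  have "inj (\<lambda>((a, t), n). p (p (g a, t), e n))"
    by (rule injI) (auto simp: inj_eq[OF p] inj_eq[OF e] inj_eq[OF g])
  then show ?thesis by blast
qed

text \<open>A function is determined by the pairs \<open>(i, n)\<close> with \<open>n\<close> in the
  code of its value at \<open>i\<close>, and \<open>f\<close> turns this relation into a subset of
  \<open>'s\<close>. The singleton around it reaches the type \<open>'s set set\<close>.\<close>

lemma inj_function_encoding:
  assumes "infinite (UNIV :: 's set)"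
  shows "\<exists>J :: ('s option \<times> 's \<Rightarrow> complex) \<Rightarrow> 's set set. inj J"
proof -
  obtain f :: "('s option \<times> 's) \<times> nat \<Rightarrow> 's" where f: "inj f"
    using inj_option_times_nat[OF assms] by blast
  obtain c :: "complex \<Rightarrow> nat set" where c: "inj c"
    using inj_complex_nat_set by blast
  have "inj (\<lambda>\<phi>. {f ` (SIGMA i:UNIV. c (\<phi> i))})"
  proof (rule injI)
    fix \<phi> \<psi> :: "'s option \<times> 's \<Rightarrow> complex"
    assume "{f ` (SIGMA i:UNIV. c (\<phi> i))} = {f ` (SIGMA i:UNIV. c (\<psi> i))}"
    then have "(SIGMA i:UNIV. c (\<phi> i)) = (SIGMA i:UNIV. c (\<psi> i))"
      using f by (simp add: inj_image_eq_iff)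
    then have "c (\<phi> i) = c (\<psi> i)" for i
      by (cases i) (simp add: set_eq_iff)
    then show "\<phi> = \<psi>"
      by (simp add: inj_eq[OF c] fun_eq_iff)
  qed
  then show ?thesis by blast
qed

section \<open>Phillips's lemma\<close>

lemma additive_Union:
  fixes m :: "nat set \<Rightarrow> real"
  assumes add: "\<And>A B. A \<inter> B = {} \<Longrightarrow> m (A \<union> B) = m A + m B"
    and T: "finite T" and disj: "\<And>i j. i \<noteq> j \<Longrightarrow> A i \<inter> A j = {}"
  shows "m (\<Union>i\<in>T. A i) = (\<Sum>i\<in>T. m (A i))"
  using T
proof (induction T rule: finite_induct)
  case empty
  have "m {} = 0" using add[of "{}" "{}"] by simp
  then show ?case by simp
next
  case (insert x F)
  have "A x \<inter> A i = {}" if "i \<in> F" for i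
    using that insert(2) by (intro disj) auto
  then have "A x \<inter> (\<Union>i\<in>F. A i) = {}" by (simp add: Int_UN_distrib)
  from add[OF this] show ?case using insert by simp
qed

text \<open>Cut \<open>B\<close> into infinitely many disjoint infinite pieces. If each contained a
  set of mass at least \<open>e\<close> in modulus, infinitely many of these would share a sign, and
  the union of enough of them would exceed the bound \<open>C\<close>.\<close>

lemma bounded_additive_small_on_infinite_subset:
  fixes m :: "nat set \<Rightarrow> real"
  assumes add: "\<And>A B. A \<inter> B = {} \<Longrightarrow> m (A \<union> B) = m A + m B"
    and bound: "\<And>A. \<bar>m A\<bar> \<le> C" and B: "infinite B" and e: "e > 0"
  shows "\<exists>B'\<subseteq>B. infinite B' \<and> (\<forall>A\<subseteq>B'. \<bar>m A\<bar> < e)"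
proof (rule ccontr)
  assume neg: "\<not> ?thesis"
  define D where "D l = enumerate B ` range (\<lambda>n. prod_encode (l, n))" for l
  have inj: "inj (enumerate B)"
    using strict_mono_enumerate[OF B] by (rule strict_mono_imp_inj_on)
  have D_sub: "D l \<subseteq> B" for l
    unfolding D_def by (auto simp: enumerate_in_set[OF B])
  have "inj (\<lambda>n. prod_encode (l, n))" for l
    by (rule injI) simp
  then have D_inf: "infinite (D l)" for l
    unfolding D_def finite_image_iff[OF inj_on_subset[OF inj subset_UNIV]] by (rule range_inj_infinite)
  have D_disj: "D i \<inter> D j = {}" if "i \<noteq> j" for i j
    using that by (auto simp: D_def inj_eq[OF inj])
  have "\<exists>A\<subseteq>D l. e \<le> \<bar>m A\<bar>" for l
  proof (rule ccontr)
    assume "\<not> ?thesis"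
    then have "\<forall>A\<subseteq>D l. \<bar>m A\<bar> < e" by (simp add: not_le)
    with D_sub[of l] D_inf[of l] have "\<exists>B'\<subseteq>B. infinite B' \<and> (\<forall>A\<subseteq>B'. \<bar>m A\<bar> < e)"
      by (intro exI[of _ "D l"] conjI)
    with neg show False by (rule notE)
  qed
  then have "\<forall>l. \<exists>A. A \<subseteq> D l \<and> e \<le> \<bar>m A\<bar>" by simp
  from choice[OF this] obtain A where A: "\<And>l. A l \<subseteq> D l" "\<And>l. e \<le> \<bar>m (A l)\<bar>"
    by auto
  have A_disj: "A i \<inter> A j = {}" if "i \<noteq> j" for i j
    using D_disj[OF that] A(1) by blast
  \<comment> \<open>Here \<open>c\<close> stands for the common sign of the masses.\<close>
  have no: "finite {l. e \<le> c * m (A l)}" if c: "c = 1 \<or> c = -1" for c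
  proof (rule ccontr)
    assume inf: "infinite {l. e \<le> c * m (A l)}"
    obtain n :: nat where n: "C < n * e"
      using reals_Archimedean3[OF e] by blast
    obtain T where T: "finite T" "card T = n" "T \<subseteq> {l. e \<le> c * m (A l)}"
      using infinite_arbitrarily_large[OF inf] by blast
    have "n * e \<le> (\<Sum>l\<in>T. c * m (A l))"
      using sum_bounded_below[of T e "\<lambda>l. c * m (A l)"] T by auto
    also have "\<dots> = c * m (\<Union>l\<in>T. A l)"
      using additive_Union[of m, OF add T(1) A_disj] by (simp add: sum_distrib_left)
    also have "\<dots> \<le> C"
      using bound[of "\<Union>l\<in>T. A l"] c by auto
    finally show False using n by simp
  qed
  have "{l. e \<le> 1 * m (A l)} \<union> {l. e \<le> -1 * m (A l)} = UNIV"
  proof (intro equalityI subsetI)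
    show "l \<in> {l. e \<le> 1 * m (A l)} \<union> {l. e \<le> -1 * m (A l)}" for l
      using A(2)[of l] by (simp add: abs_if split: if_splits)
  qed simp
  moreover have "finite ({l. e \<le> 1 * m (A l)} \<union> {l. e \<le> -1 * m (A l)})"
    using no[of 1] no[of "-1"] by simp
  ultimately show False by simp
qed

text \<open>The diagonal case of Phillips's lemma, by a gliding hump: a subsequence is chosen so that
  the earlier indices and the later ones contribute little at each chosen index.\<close>

lemma Phillips_diagonal:
  fixes m :: "nat \<Rightarrow> nat set \<Rightarrow> real"
  assumes add: "\<And>k A B. A \<inter> B = {} \<Longrightarrow> m k (A \<union> B) = m k A + m k B"
    and bound: "\<And>k A. \<bar>m k A\<bar> \<le> C k" and lim: "\<And>A. (\<lambda>k. m k A) \<longlonglongrightarrow> 0" and d: "d > 0"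
  shows "\<exists>k. m k {k} < d"
proof (rule ccontr)
  assume "\<not> ?thesis"
  then have diag: "d \<le> m k {k}" for k by (simp add: not_less)
  \<comment> \<open>\<open>B\<close> is a reservoir of later indices whose total influence on
    \<open>m k\<close> is small, however they are selected.\<close>
  define good where "good k B \<longleftrightarrow> infinite B \<and> B \<subseteq> {k<..} \<and> (\<forall>A\<subseteq>B. \<bar>m k A\<bar> < d / 4)" for k B
  have extend: "\<exists>B'\<subseteq>B. good k B'" if "infinite B" for k B
  proof -
    have "B - {..k} = B \<inter> {k<..}" by auto
    then have "infinite (B \<inter> {k<..})"
      using Diff_infinite_finite[OF finite_atMost[of k] that] by simp
    then obtain B' where "B' \<subseteq> B \<inter> {k<..}" "infinite B'" "\<forall>A\<subseteq>B'. \<bar>m k A\<bar> < d / 4"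
      using bounded_additive_small_on_infinite_subset[of "m k" "C k" "B \<inter> {k<..}" "d / 4"] add bound d by force
    then show ?thesis unfolding good_def by (intro exI[of _ B']) simp
  qed
  \<comment> \<open>A state consists of the index chosen last and its reservoir; the next index
    comes from the reservoir and is insensitive to all sets of indices up to the last one.\<close>
  define step where "step p q \<longleftrightarrow> fst q \<in> snd p \<and> snd q \<subseteq> snd p \<and> (\<forall>D\<subseteq>{..fst p}. \<bar>m (fst q) D\<bar> < d / 4)"
    for p q :: "nat \<times> nat set"
  have successor: "\<exists>q. good (fst q) (snd q) \<and> step p q" if p: "good (fst p) (snd p)" for p :: "nat \<times> nat set"
  proof -
    \<comment> \<open>Only finitely many sets lie below the last index, so pointwise convergence to
      0 is uniform over them.\<close>
    have "\<forall>\<^sub>F k in sequentially. \<forall>D\<in>Pow {..fst p}. \<bar>m k D\<bar> < d / 4"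
    proof (rule eventually_ball_finite)
      show "\<forall>D\<in>Pow {..fst p}. \<forall>\<^sub>F k in sequentially. \<bar>m k D\<bar> < d / 4"
        using tendstoD[OF lim, of "d / 4"] d by (simp add: dist_real_def)
    qed simp
    then obtain K where K: "\<And>k. k \<ge> K \<Longrightarrow> \<forall>D\<in>Pow {..fst p}. \<bar>m k D\<bar> < d / 4"
      unfolding eventually_sequentially by blast
    have inf: "infinite (snd p)" using p by (simp add: good_def)
    then obtain k where k: "k \<ge> K" "k \<in> snd p"
      unfolding infinite_nat_iff_unbounded_le by blast
    obtain B' where "B' \<subseteq> snd p" "good k B'"
      using extend[OF inf] by blast
    then show ?thesis
      using k K[OF k(1)] by (intro exI[of _ "(k, B')"]) (auto simp: step_def)
  qed
  obtain B0 where B0: "good 0 B0" using extend[of UNIV 0] by auto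
  have "\<exists>p. good (fst p) (snd p)" using B0 by (intro exI[of _ "(0, B0)"]) simp
  then obtain f :: "nat \<Rightarrow> nat \<times> nat set"
    where good: "\<And>n. good (fst (f n)) (snd (f n))" and step: "\<And>n. step (f n) (f (Suc n))"
    using dependent_nat_choice[of "\<lambda>_ p. good (fst p) (snd p)" "\<lambda>_. step"] successor by auto
  define k where "k n = fst (f n)" for n
  define B where "B n = snd (f n)" for n
  have k_B: "k (Suc n) \<in> B n" and B_Suc: "B (Suc n) \<subseteq> B n"
    and early: "D \<subseteq> {..k n} \<Longrightarrow> \<bar>m (k (Suc n)) D\<bar> < d / 4" for n D
    using step[of n] by (auto simp: step_def k_def B_def)
  have B_gt: "B n \<subseteq> {k n<..}" and late: "D \<subseteq> B n \<Longrightarrow> \<bar>m (k n) D\<bar> < d / 4" for n D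
    using good[of n] by (auto simp: good_def k_def B_def)
  have B_anti: "B j \<subseteq> B i" if "i \<le> j" for i j
    using that B_Suc by (rule lift_Suc_antimono_le[rotated])
  have k_mono: "strict_mono k"
    unfolding strict_mono_Suc_iff using k_B B_gt by blast
  \<comment> \<open>The earlier and the later indices each cost less than \<open>d / 4\<close>
    against a diagonal term of at least \<open>d\<close>. As \<open>range k\<close> does not vary
    with \<open>n\<close>, this contradicts \<open>lim\<close>.\<close>
  have "d / 2 \<le> m (k (Suc n)) (range k)" for n
  proof -
    let ?E = "range k \<inter> {..k n}" and ?L = "range k \<inter> {k (Suc n)<..}"
    have split: "range k = ?E \<union> ({k (Suc n)} \<union> ?L)"
    proof (intro equalityI subsetI)
      fix x assume "x \<in> range k"
      then obtain j where j: "x = k j" by blast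
      consider "j \<le> n" | "j = Suc n" | "Suc n < j" by linarith
      then show "x \<in> ?E \<union> ({k (Suc n)} \<union> ?L)"
        using strict_mono_less[OF k_mono] strict_mono_less_eq[OF k_mono] j by cases auto
    qed auto
    have "?L \<subseteq> B (Suc n)"
    proof
      fix x assume "x \<in> ?L"
      then obtain j where j: "x = k j" "Suc n < j"
        using strict_mono_less[OF k_mono] by auto
      then obtain i where i: "j = Suc i" "Suc n \<le> i"
        by (cases j) auto
      show "x \<in> B (Suc n)"
        using k_B[of i] B_anti[OF i(2)] i j by auto
    qed
    moreover have "k n < k (Suc n)" using k_mono by (simp add: strict_mono_Suc_iff)
    then have "?E \<inter> ({k (Suc n)} \<union> ?L) = {}" by auto
    then have "m (k (Suc n)) (range k) = m (k (Suc n)) ?E + m (k (Suc n)) ({k (Suc n)} \<union> ?L)"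
      by (subst split) (rule add)
    moreover have "m (k (Suc n)) ({k (Suc n)} \<union> ?L) = m (k (Suc n)) {k (Suc n)} + m (k (Suc n)) ?L"
      by (rule add) auto
    moreover have "\<bar>m (k (Suc n)) ?E\<bar> < d / 4" by (rule early) simp
    moreover note late[of ?L "Suc n"] diag[of "k (Suc n)"]
    ultimately show ?thesis by linarith
  qed
  moreover have "(\<lambda>n. m (k (Suc n)) (range k)) \<longlonglongrightarrow> 0"
    using LIMSEQ_Suc[OF LIMSEQ_subseq_LIMSEQ[OF lim k_mono]] by (simp add: o_def)
  ultimately have "d / 2 \<le> 0"
    by (intro LIMSEQ_le_const) auto
  with d show False by simp
qed

section \<open>Retractions commuting with translations\<close>

text \<open>The type \<open>'s option\<close> is the unitization, with \<open>None\<close> as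
  adjoined unit. A product with one factor in the semigroup stays in the semigroup, hence the mixed
  products \<open>rmul\<close> and \<open>lmul\<close>.\<close>

definition rmul :: "'s::semigroup_mult \<Rightarrow> 's option \<Rightarrow> 's" where
  "rmul t a = (case a of None \<Rightarrow> t | Some b \<Rightarrow> t * b)"

definition lmul :: "'s option \<Rightarrow> 's::semigroup_mult \<Rightarrow> 's" where
  "lmul a s = (case a of None \<Rightarrow> s | Some b \<Rightarrow> b * s)"

text \<open>The product of \<open>\<omega>\<close> with its extension to the unitization by 1 at the
  adjoined unit.\<close>

definition pair_weight :: "('s \<Rightarrow> real) \<Rightarrow> 's option \<times> 's \<Rightarrow> real" where
  "pair_weight \<omega> = (\<lambda>(a, t). (case a of None \<Rightarrow> 1 | Some b \<Rightarrow> \<omega> b) * \<omega> t)"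

lemma rmul_lmul: "t * lmul a s = rmul t a * s"
  by (simp add: rmul_def lmul_def mult.assoc split: option.split)

lemma rmul_mult: "s * rmul t a = rmul (s * t) a"
  by (simp add: rmul_def mult.assoc split: option.split)

lemma lmul_mult: "lmul (Some (lmul a s)) t = lmul a (s * t)"
  by (simp add: lmul_def mult.assoc split: option.split)

lemma rmul_Some: "rmul t (Some b) = t * b"
  by (simp add: rmul_def)

context
  fixes \<omega> :: "'s::semigroup_mult \<Rightarrow> real"
  assumes \<omega>: "weight \<omega>"
begin

lemma weight_pos: "\<omega> s > 0" and weight_mult_le: "\<omega> (s * t) \<le> \<omega> s * \<omega> t"
  using \<omega> by (simp_all add: weight_def)

lemma pair_weight_pos: "pair_weight \<omega> i > 0"
  by (simp add: pair_weight_def weight_pos split: prod.split option.split)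

lemma pair_weight_rmul: "\<omega> (rmul t a) \<le> pair_weight \<omega> (a, t)"
  using weight_mult_le[of t] by (simp add: pair_weight_def rmul_def mult.commute split: option.split)

lemma pair_weight_lmul: "pair_weight \<omega> (Some (lmul a s), t) \<le> \<omega> s * pair_weight \<omega> (a, t)"
proof (cases a)
  case (Some b)
  have "\<omega> (b * s) * \<omega> t \<le> \<omega> b * \<omega> s * \<omega> t"
    using weight_mult_le[of b s] weight_pos[of t] by (intro mult_right_mono) auto
  then show ?thesis by (simp add: Some lmul_def pair_weight_def mult_ac)
qed (simp add: lmul_def pair_weight_def)

lemma pair_weight_mult_left: "pair_weight \<omega> (a, s * t) \<le> \<omega> s * pair_weight \<omega> (a, t)"
proof -
  have "(case a of None \<Rightarrow> 1 | Some b \<Rightarrow> \<omega> b) * \<omega> (s * t)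
      \<le> (case a of None \<Rightarrow> 1 | Some b \<Rightarrow> \<omega> b) * (\<omega> s * \<omega> t)"
    using weight_mult_le[of s t] by (intro mult_left_mono) (auto simp: weight_pos less_imp_le split: option.split)
  then show ?thesis by (simp add: pair_weight_def mult_ac)
qed

end

lemma weakly_cancellative_finite:
  assumes "weakly_cancellative TYPE('s::semigroup_mult)"
  shows "finite {t::'s. s * t = u}" "finite {t::'s. t * s = u}"
  using assms by (simp_all add: weakly_cancellative_def)

lemma weakly_cancellative_finite_rmul:
  assumes "weakly_cancellative TYPE('s::semigroup_mult)"
  shows "finite {t::'s. rmul t a = u}"
  using weakly_cancellative_finite(2)[OF assms] by (cases a) (simp_all add: rmul_def)

definition indic :: "bool \<Rightarrow> complex" where "indic P = (if P then 1 else 0)"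

lemma norm_indic: "cmod (indic P) = (if P then 1 else 0)"
  by (simp add: indic_def)

text \<open>In a retraction \<open>\<rho>\<close> of the functions on \<open>S\<^sup>#\<times>S\<close> onto those on \<open>S\<close>, the weights are
  undone: \<open>\<rho> f y / \<omega> y\<close> is the value at \<open>y\<close> of the image of \<open>f / pair_weight \<omega>\<close>, so that
  \<open>\<rho>\<close> commutes with plain translations.\<close>

locale translation_retract =
  fixes \<omega> :: "'s::semigroup_mult \<Rightarrow> real" and \<rho> :: "('s option \<times> 's \<Rightarrow> complex) \<Rightarrow> 's \<Rightarrow> complex"
    and \<G> :: "('s option \<times> 's \<Rightarrow> complex) set" and C :: real
  assumes \<omega>: "weight \<omega>" and wc: "weakly_cancellative TYPE('s)"
    and \<G>_def: "\<G> = {f. (\<exists>B. \<forall>i. cmod (f i) \<le> B * pair_weight \<omega> i) \<and> (\<forall>a. finite {t. f (a, t) \<noteq> 0})}"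
    and add: "f \<in> \<G> \<Longrightarrow> g \<in> \<G> \<Longrightarrow> \<rho> (\<lambda>i. f i + g i) y = \<rho> f y + \<rho> g y"
    and scale: "f \<in> \<G> \<Longrightarrow> \<rho> (\<lambda>i. c * f i) y = c * \<rho> f y"
    and bound: "f \<in> \<G> \<Longrightarrow> (\<And>i. cmod (f i) \<le> B * pair_weight \<omega> i) \<Longrightarrow> cmod (\<rho> f y) \<le> C * B * \<omega> y"
    and vanish: "f \<in> \<G> \<Longrightarrow> e > 0 \<Longrightarrow> finite {y. e * \<omega> y \<le> cmod (\<rho> f y)}"
    and left: "f \<in> \<G> \<Longrightarrow> \<rho> (\<lambda>(a, t). f (Some (lmul a s), t)) y = \<rho> f (y * s)"
    and right: "f \<in> \<G> \<Longrightarrow> \<rho> (\<lambda>(a, t). f (a, s * t)) y = \<rho> f (s * y)"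
    and unit: "\<rho> (\<lambda>(a, t). indic (rmul t a = x)) x = 1"
begin

lemma \<G>_I:
  assumes "\<And>i. cmod (f i) \<le> B * pair_weight \<omega> i" "\<And>a. finite {t. f (a, t) \<noteq> 0}"
  shows "f \<in> \<G>"
  using assms by (auto simp: \<G>_def)

lemma zero_in_\<G>: "(\<lambda>_. 0) \<in> \<G>"
  by (rule \<G>_I[of _ 0]) auto

lemma rho_zero: "\<rho> (\<lambda>_. 0) y = 0"
  using scale[OF zero_in_\<G>, of 0 y] by simp

lemma \<G>_scale:
  assumes "f \<in> \<G>"
  shows "(\<lambda>i. c * f i) \<in> \<G>"
proof -
  obtain B where B: "\<And>i. cmod (f i) \<le> B * pair_weight \<omega> i" "\<And>a. finite {t. f (a, t) \<noteq> 0}"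
    using assms by (auto simp: \<G>_def)
  show ?thesis
  proof (rule \<G>_I)
    show "cmod (c * f i) \<le> cmod c * B * pair_weight \<omega> i" for i
      using mult_left_mono[OF B(1)[of i], of "cmod c"] by (simp add: norm_mult mult_ac)
    show "finite {t. c * f (a, t) \<noteq> 0}" for a
      by (rule finite_subset[OF _ B(2)[of a]]) auto
  qed
qed

lemma \<G>_add:
  assumes "f \<in> \<G>" "g \<in> \<G>"
  shows "(\<lambda>i. f i + g i) \<in> \<G>"
proof -
  obtain B where B: "\<And>i. cmod (f i) \<le> B * pair_weight \<omega> i" "\<And>a. finite {t. f (a, t) \<noteq> 0}"
    using assms(1) by (auto simp: \<G>_def)
  obtain D where D: "\<And>i. cmod (g i) \<le> D * pair_weight \<omega> i" "\<And>a. finite {t. g (a, t) \<noteq> 0}"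
    using assms(2) by (auto simp: \<G>_def)
  show ?thesis
  proof (rule \<G>_I)
    show "cmod (f i + g i) \<le> (B + D) * pair_weight \<omega> i" for i
      using norm_triangle_le[OF add_mono[OF B(1) D(1)], of i i] by (simp add: distrib_right)
    show "finite {t. f (a, t) + g (a, t) \<noteq> 0}" for a
      by (rule finite_subset[OF _ finite_UnI[OF B(2)[of a] D(2)[of a]]]) auto
  qed
qed

lemma rho_sum:
  assumes "finite A" "\<And>k. k \<in> A \<Longrightarrow> f k \<in> \<G>"
  shows "(\<lambda>i. \<Sum>k\<in>A. f k i) \<in> \<G> \<and> \<rho> (\<lambda>i. \<Sum>k\<in>A. f k i) y = (\<Sum>k\<in>A. \<rho> (f k) y)"
  using assms
proof (induction A rule: finite_induct)
  case (insert k A)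
  then have "f k \<in> \<G>" "(\<lambda>i. \<Sum>k\<in>A. f k i) \<in> \<G>" "\<rho> (\<lambda>i. \<Sum>k\<in>A. f k i) y = (\<Sum>k\<in>A. \<rho> (f k) y)"
    by auto
  then show ?case
    using insert(1,2) \<G>_add[of "f k" "\<lambda>i. \<Sum>k\<in>A. f k i"] add[of "f k" "\<lambda>i. \<Sum>k\<in>A. f k i" y] by simp
qed (simp add: zero_in_\<G> rho_zero)

lemma left_in_\<G>:
  assumes "f \<in> \<G>"
  shows "(\<lambda>(a, t). f (Some (lmul a s), t)) \<in> \<G>"
proof -
  obtain B where B: "\<And>i. cmod (f i) \<le> B * pair_weight \<omega> i" "\<And>a. finite {t. f (a, t) \<noteq> 0}"
    using assms by (auto simp: \<G>_def)
  have "0 \<le> B * pair_weight \<omega> (None, undefined)"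
    by (rule order_trans[OF norm_ge_zero B(1)])
  then have "B \<ge> 0"
    using pair_weight_pos[OF \<omega>, of "(None, undefined)"] by (auto simp: zero_le_mult_iff)
  show ?thesis
  proof (rule \<G>_I)
    show "cmod ((\<lambda>(a, t). f (Some (lmul a s), t)) i) \<le> B * \<omega> s * pair_weight \<omega> i" for i
      using order_trans[OF B(1) mult_left_mono[OF pair_weight_lmul[OF \<omega>] \<open>B \<ge> 0\<close>], of "fst i" s "snd i"]
      by (simp add: case_prod_beta mult.assoc)
    show "finite {t. (\<lambda>(a, t). f (Some (lmul a s), t)) (a, t) \<noteq> 0}" for a
      using B(2) by simp
  qed
qed

text \<open>On the support the weight of \<open>(a, t)\<close> is at least \<open>\<omega> x\<close>
  by submultiplicativity, and weak cancellativity leaves finitely many \<open>t\<close> for each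
  \<open>a\<close>.\<close>

lemma indicator_in_\<G>:
  "(\<lambda>(a, t). indic (rmul t a = x \<and> P a t)) \<in> \<G>"
proof (rule \<G>_I)
  show "cmod ((\<lambda>(a, t). indic (rmul t a = x \<and> P a t)) i) \<le> 1 / \<omega> x * pair_weight \<omega> i" for i
    using pair_weight_rmul[OF \<omega>, of "snd i" "fst i"] weight_pos[OF \<omega>, of x] pair_weight_pos[OF \<omega>, of i]
    by (auto simp: norm_indic case_prod_beta less_imp_le)
  show "finite {t. (\<lambda>(a, t). indic (rmul t a = x \<and> P a t)) (a, t) \<noteq> 0}" for a
    by (rule finite_subset[OF _ weakly_cancellative_finite_rmul[OF wc, of a x]]) (auto simp: indic_def)
qed

lemma cancellative_unital:
  assumes "cancellative TYPE('s)"
  shows "unital TYPE('s)"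
proof -
  have cl: "s * t = s * u \<Longrightarrow> t = u" and cr: "t * s = u * s \<Longrightarrow> t = u" for s t u :: 's
    using assms unfolding cancellative_def inj_def by blast+
  fix s x :: 's
  \<comment> \<open>The clause on \<open>a\<close> always holds at the points where the left
    translate by \<open>s\<close> evaluates \<open>f\<close>, but it confines the support of the
    right translate to products ending in \<open>s\<close>.\<close>
  define f :: "'s option \<times> 's \<Rightarrow> complex"
    where "f = (\<lambda>(a, t). indic (rmul t a = x * s \<and> (\<exists>b. a = Some (lmul b s))))"
  have f: "f \<in> \<G>"
    unfolding f_def by (rule indicator_in_\<G>)
  have "(\<lambda>(a, t). f (Some (lmul a s), t)) = (\<lambda>(a, t). indic (rmul t a = x))"
    by (auto simp: f_def fun_eq_iff rmul_Some rmul_lmul indic_def dest: cr)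
  then have "\<rho> f (x * s) = 1"
    using left[OF f, of s x] unit[of x] by simp
  then have "\<rho> (\<lambda>(a, t). f (a, x * t)) s = 1"
    using right[OF f, of x s] by simp
  then have "(\<lambda>(a, t). f (a, x * t)) \<noteq> (\<lambda>_. 0)"
    using rho_zero[of s] by auto
  then obtain a t where "f (a, x * t) \<noteq> 0" by (auto simp: fun_eq_iff)
  then obtain b where b: "rmul (x * t) (Some (lmul b s)) = x * s"
    by (auto simp: f_def indic_def split: if_splits)
  define p where "p = rmul t b"
  from b have "x * (p * s) = x * s"
    by (simp add: p_def rmul_Some rmul_lmul[symmetric] mult.assoc)
  then have "p * s = s" by (rule cl)
  \<comment> \<open>An element fixing \<open>s\<close> from the left is idempotent by right
    cancellation, and cancelling an idempotent shows it to be a two-sided unit.\<close>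
  then have "p * p * s = p * s" by (simp add: mult.assoc)
  then have pp: "p * p = p" by (rule cr)
  have "p * z = z" for z
    by (rule cl[of p]) (simp add: mult.assoc[symmetric] pp)
  moreover have "z * p = z" for z
    by (rule cr[of _ p]) (simp add: mult.assoc pp)
  ultimately show ?thesis
    by (auto simp: unital_def is_unit_of_def)
qed

end

text \<open>Weak cancellativity makes the classes of the equivalence relation generated by \<open>y \<sim> y x\<close>,
  \<open>x \<in> X\<close>, countable; \<open>\<kappa>\<close> enumerates each class.\<close>

lemma orbit_labelling:
  fixes X :: "'s::semigroup_mult set"
  assumes wc: "weakly_cancellative TYPE('s)" and X: "countable X"
  obtains \<kappa> :: "'s \<Rightarrow> nat" where "\<And>a. inj_on \<kappa> ((\<lambda>x. a * x) ` X)"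
proof -
  define R where "R = {(y, y * x) | y x. x \<in> X}"
  define cls where "cls y = (R \<union> R\<inverse>)\<^sup>* `` {y}" for y
  have "countable ((R \<union> R\<inverse>) `` Y)" if "countable Y" for Y
  proof -
    have "(R \<union> R\<inverse>) `` Y \<subseteq> (\<Union>y\<in>Y. (\<lambda>x. y * x) ` X) \<union> (\<Union>y\<in>Y. \<Union>x\<in>X. {z. z * x = y})"
      by (auto simp: R_def)
    moreover have "countable {z. z * x = y}" for x y :: 's
      by (rule countable_finite[OF weakly_cancellative_finite(2)[OF wc]])
    then have "countable ((\<Union>y\<in>Y. (\<lambda>x. y * x) ` X) \<union> (\<Union>y\<in>Y. \<Union>x\<in>X. {z. z * x = y}))"
      using that X by simp
    ultimately show ?thesis by (rule countable_subset)
  qed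
  then have countable_cls: "countable (cls y)" for y
    unfolding cls_def by (rule countable_rtrancl) simp_all
  \<comment> \<open>All products \<open>a * x\<close> thus lie in the one countable class of
    \<open>a\<close>, on which \<open>to_nat_on\<close> is injective.\<close>
  have cls_eq: "cls (a * x) = cls a" if "x \<in> X" for a x
  proof -
    have sym: "sym ((R \<union> R\<inverse>)\<^sup>*)"
      by (intro sym_rtrancl sym_Un_converse)
    have edge: "(a, a * x) \<in> (R \<union> R\<inverse>)\<^sup>*"
      using that by (intro r_into_rtrancl) (auto simp: R_def)
    show ?thesis
      unfolding cls_def using edge symD[OF sym edge] by (auto intro: rtrancl_trans)
  qed
  show thesis
  proof (rule that[of "\<lambda>y. to_nat_on (cls y) y"], rule inj_onI)
    fix a y z
    assume y: "y \<in> (\<lambda>x. a * x) ` X" and z: "z \<in> (\<lambda>x. a * x) ` X"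
      and eq: "to_nat_on (cls y) y = to_nat_on (cls z) z"
    have "cls y = cls a" "cls z = cls a" using y z cls_eq by auto
    moreover have "y \<in> cls y" "z \<in> cls z" by (simp_all add: cls_def)
    ultimately show "y = z"
      using eq inj_on_to_nat_on[OF countable_cls[of a]] by (simp add: inj_on_def)
  qed
qed

section \<open>The unital case: small diagonal masses and the contradiction with Phillips's
  lemma\<close>

context translation_retract
begin

text \<open>Translated to the unit \<open>e\<close>, the values \<open>\<Lambda> (\<xi> n)\<close>
  are all read off at the same point. At most \<open>N\<close> of the translated indicators overlap
  anywhere, so a signed sum of many of them stays bounded while its value at \<open>e\<close> would
  grow without bound.\<close>

lemma small_mass:
  fixes \<xi> :: "nat \<Rightarrow> 's" and \<kappa> :: "'s \<Rightarrow> nat" and e :: 's and N :: nat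
  assumes e: "is_unit_of e" and \<xi>: "inj \<xi>" and \<kappa>: "\<And>a. inj_on \<kappa> ((\<lambda>x. a * x) ` range \<xi>)"
  defines "\<Lambda> \<equiv> \<lambda>x. \<rho> (\<lambda>(a, t). indic (rmul t a = x \<and> (\<forall>b. a = Some b \<longrightarrow> \<kappa> b < N))) x"
  shows "finite {n. 1 / 2 < cmod (\<Lambda> (\<xi> n))}"
proof (rule ccontr)
  assume inf: "infinite {n. 1 / 2 < cmod (\<Lambda> (\<xi> n))}"
  have ex: "e * s = s" for s using e by (simp add: is_unit_of_def)
  define f :: "'s \<Rightarrow> 's option \<times> 's \<Rightarrow> complex"
    where "f x = (\<lambda>(a, t). indic (rmul t a = x \<and> (\<forall>b. a = Some b \<longrightarrow> \<kappa> b < N)))" for x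
  define g where "g x = (\<lambda>(a, t). f x (Some (lmul a x), t))" for x
  have f: "f x \<in> \<G>" for x
    unfolding f_def by (rule indicator_in_\<G>)
  have g: "g x \<in> \<G>" for x
    unfolding g_def by (rule left_in_\<G>[OF f])
  have rho_g: "\<rho> (g x) e = \<Lambda> x" for x
    unfolding g_def left[OF f] ex by (simp add: \<Lambda>_def f_def)
  have g_eq: "g x (a, t) = indic (rmul t a * x = x \<and> \<kappa> (lmul a x) < N)" for x a t
    by (simp add: g_def f_def rmul_Some rmul_lmul)
  \<comment> \<open>An element that fixes some \<open>x\<close> has weight at least 1. This makes
    the bound by \<open>pair_weight\<close> uniform in \<open>x\<close>.\<close>
  have weight_ge: "1 \<le> pair_weight \<omega> (a, t)" if "rmul t a * x = x" for a t x
  proof -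
    have "\<omega> x \<le> \<omega> (rmul t a) * \<omega> x"
      using weight_mult_le[OF \<omega>, of "rmul t a" x] that by simp
    then have "1 \<le> \<omega> (rmul t a)"
      using weight_pos[OF \<omega>, of x] by simp
    also have "\<dots> \<le> pair_weight \<omega> (a, t)"
      by (rule pair_weight_rmul[OF \<omega>])
    finally show ?thesis .
  qed
  have \<kappa>_lmul: "lmul a (\<xi> m) = lmul a (\<xi> n)" if "\<kappa> (lmul a (\<xi> m)) = \<kappa> (lmul a (\<xi> n))" for a m n
  proof -
    obtain c where c: "\<And>s. lmul a s = c * s"
    proof
      show "lmul a s = (case a of None \<Rightarrow> e | Some b \<Rightarrow> b) * s" for s
        by (simp add: lmul_def ex split: option.split)
    qed
    have "\<kappa> (c * \<xi> m) = \<kappa> (c * \<xi> n)" using that by (simp only: c)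
    then have "c * \<xi> m = c * \<xi> n" by (rule inj_onD[OF \<kappa>[of c]]) simp_all
    then show ?thesis by (simp only: c)
  qed
  \<comment> \<open>Below \<open>N\<close> there are only \<open>N\<close> labels. The label of
    \<open>lmul a (\<xi> n)\<close> determines that product, and multiplying it by \<open>t\<close>
    recovers \<open>\<xi> n\<close>.\<close>
  have overlap: "card {n\<in>Y. rmul t a * \<xi> n = \<xi> n \<and> \<kappa> (lmul a (\<xi> n)) < N} \<le> N" (is "card ?Z \<le> N")
    for Y a t
  proof -
    have "inj_on (\<lambda>n. \<kappa> (lmul a (\<xi> n))) ?Z"
    proof (rule inj_onI)
      fix m n assume m: "m \<in> ?Z" and n: "n \<in> ?Z" and eq: "\<kappa> (lmul a (\<xi> m)) = \<kappa> (lmul a (\<xi> n))"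
      have "\<xi> m = t * lmul a (\<xi> m)" using m by (simp add: rmul_lmul)
      also have "\<dots> = t * lmul a (\<xi> n)" by (simp only: \<kappa>_lmul[OF eq])
      also have "\<dots> = \<xi> n" using n by (simp add: rmul_lmul)
      finally have "\<xi> m = \<xi> n" .
      then show "m = n" by (simp add: inj_eq[OF \<xi>])
    qed
    then have "card ?Z \<le> card {..<N}"
      by (rule card_inj_on_le) (simp_all add: image_subset_iff)
    then show ?thesis by simp
  qed
  obtain M :: nat where M: "C * N * \<omega> e < M * (1 / 2)"
    using ex_less_of_nat_mult[of "1 / 2" "C * N * \<omega> e"] by auto
  obtain Y where Y: "finite Y" "card Y = M" "Y \<subseteq> {n. 1 / 2 < cmod (\<Lambda> (\<xi> n))}"
    using infinite_arbitrarily_large[OF inf] by blast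
  \<comment> \<open>The conjugate phases turn each summand of \<open>\<rho> h e\<close> into the
    modulus of \<open>\<Lambda> (\<xi> n)\<close>.\<close>
  define h where "h = (\<lambda>i. \<Sum>n\<in>Y. cnj (sgn (\<Lambda> (\<xi> n))) * g (\<xi> n) i)"
  have h: "h \<in> \<G>" "\<rho> h e = (\<Sum>n\<in>Y. cnj (sgn (\<Lambda> (\<xi> n))) * \<Lambda> (\<xi> n))"
    using rho_sum[OF Y(1), of "\<lambda>n i. cnj (sgn (\<Lambda> (\<xi> n))) * g (\<xi> n) i" e] \<G>_scale[OF g]
    by (simp_all add: h_def scale[OF g] rho_g)
  have "cmod (h i) \<le> N * pair_weight \<omega> i" for i
  proof -
    obtain a t where i: "i = (a, t)" by (cases i)
    let ?Z = "{n\<in>Y. rmul t a * \<xi> n = \<xi> n \<and> \<kappa> (lmul a (\<xi> n)) < N}"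
    have "cmod (h i) \<le> (\<Sum>n\<in>Y. cmod (cnj (sgn (\<Lambda> (\<xi> n))) * g (\<xi> n) i))"
      unfolding h_def by (rule norm_sum)
    also have "\<dots> \<le> (\<Sum>n\<in>Y. if rmul t a * \<xi> n = \<xi> n \<and> \<kappa> (lmul a (\<xi> n)) < N then 1 else 0)"
      by (intro sum_mono) (auto simp: i g_eq norm_mult norm_indic norm_sgn)
    also have "\<dots> = card ?Z"
      using Y(1) by (simp add: sum.If_cases Int_def)
    finally have le: "cmod (h i) \<le> card ?Z" .
    show ?thesis
    proof (cases "?Z = {}")
      case True
      then show ?thesis
        using le pair_weight_pos[OF \<omega>, of i] by (simp del: Collect_empty_eq)
    next
      case False
      then obtain n where "rmul t a * \<xi> n = \<xi> n" by blast
      then have "1 \<le> pair_weight \<omega> i" unfolding i by (rule weight_ge)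
      then have "real N * 1 \<le> N * pair_weight \<omega> i" by (intro mult_left_mono) auto
      then show ?thesis using le overlap[of Y t a] by linarith
    qed
  qed
  then have "cmod (\<rho> h e) \<le> C * N * \<omega> e"
    by (rule bound[OF h(1)])
  moreover have "\<rho> h e = of_real (\<Sum>n\<in>Y. cmod (\<Lambda> (\<xi> n)))"
  proof -
    have "cnj (sgn z) * z = of_real (cmod z)" for z
      by (cases "z = 0") (simp_all add: sgn_div_norm scaleR_conv_of_real complex_norm_square[symmetric]
          mult.assoc power2_eq_square mult.commute[of "cnj z"])
    then show ?thesis by (simp add: h(2))
  qed
  moreover have "M * (1 / 2) \<le> (\<Sum>n\<in>Y. cmod (\<Lambda> (\<xi> n)))"
    using sum_bounded_below[of Y "1 / 2" "\<lambda>n. cmod (\<Lambda> (\<xi> n))"] Y by force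
  ultimately show False
    using M by (simp del: of_real_sum)
qed

lemma not_unital:
  assumes inf: "infinite (UNIV :: 's set)"
  shows "\<not> unital TYPE('s)"
proof
  assume "unital TYPE('s)"
  then obtain e :: 's where e: "is_unit_of e" by (auto simp: unital_def)
  obtain \<xi> :: "nat \<Rightarrow> 's" where \<xi>: "inj \<xi>"
    using inf infinite_countable_subset by blast
  obtain \<kappa> :: "'s \<Rightarrow> nat" where \<kappa>: "\<And>a. inj_on \<kappa> ((\<lambda>x. a * x) ` range \<xi>)"
    using orbit_labelling[OF wc, of "range \<xi>"] by auto
  \<comment> \<open>The sets of \<open>a\<close> with \<open>low N a\<close> increase to the whole
    unitization; \<open>None\<close> belongs to each of them.\<close>
  define low where "low N a \<longleftrightarrow> (\<forall>b. a = Some b \<longrightarrow> \<kappa> b < N)" for N a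
  define \<Lambda> where "\<Lambda> N x = \<rho> (\<lambda>(a, t). indic (rmul t a = x \<and> low N a)) x" for N x
  have "\<forall>N. \<exists>K. \<forall>k\<ge>K. cmod (\<Lambda> N (\<xi> k)) \<le> 1 / 2"
  proof
    fix N
    have "finite {k. \<not> cmod (\<Lambda> N (\<xi> k)) \<le> 1 / 2}"
      using small_mass[OF e \<xi> \<kappa>, of N] unfolding \<Lambda>_def low_def not_le .
    then show "\<exists>K. \<forall>k\<ge>K. cmod (\<Lambda> N (\<xi> k)) \<le> 1 / 2"
      unfolding cofinite_eq_sequentially[symmetric] eventually_cofinite[symmetric] eventually_sequentially[symmetric] .
  qed
  from choice[OF this] obtain K where K: "\<And>N k. K N \<le> k \<Longrightarrow> cmod (\<Lambda> N (\<xi> k)) \<le> 1 / 2"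
    by auto
  \<comment> \<open>A strictly increasing sequence that dominates \<open>K\<close> termwise.\<close>
  define r where "r n = n + (\<Sum>i\<le>n. K i)" for n
  have "strict_mono r" by (simp add: strict_mono_Suc_iff r_def)
  have "K n \<le> r n" for n
    using member_le_sum[of n "{..n}" K] by (simp add: r_def trans_le_add2)
  define x where "x n = \<xi> (r n)" for n
  have \<Lambda>_x: "cmod (\<Lambda> n (x n)) \<le> 1 / 2" for n
    unfolding x_def by (rule K[OF \<open>K n \<le> r n\<close>])
  have x: "inj x"
    by (rule injI) (simp add: x_def inj_eq[OF \<xi>] strict_mono_eq[OF \<open>strict_mono r\<close>])

  \<comment> \<open>For fixed \<open>a\<close>, only finitely many \<open>n\<close> satisfy
    \<open>\<not> low n a\<close>; hence the support stays finite over each \<open>a\<close> even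
    for infinite \<open>A\<close>. The factor equals \<open>\<omega> (x n)\<close> on the support
    and normalises the diagonal.\<close>
  define \<phi> :: "nat set \<Rightarrow> 's option \<times> 's \<Rightarrow> complex"
    where "\<phi> A = (\<lambda>(a, t). of_real (\<omega> (rmul t a)) * indic (\<exists>n\<in>A. rmul t a = x n \<and> \<not> low n a))" for A
  have \<phi>_le: "cmod (\<phi> A i) \<le> 1 * pair_weight \<omega> i" for A i
    using pair_weight_rmul[OF \<omega>, of "snd i" "fst i"] pair_weight_pos[OF \<omega>, of i]
      weight_pos[OF \<omega>, of "rmul (snd i) (fst i)"]
    by (simp add: \<phi>_def case_prod_beta norm_mult norm_indic)
  have \<phi>: "\<phi> A \<in> \<G>" for A
  proof (rule \<G>_I[OF \<phi>_le])
    fix a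
    have "{n. \<not> low n a} \<subseteq> (case a of None \<Rightarrow> {} | Some b \<Rightarrow> {..\<kappa> b})"
      by (auto simp: low_def split: option.split)
    then have "finite {n. \<not> low n a}"
      by (rule finite_subset) (simp split: option.split)
    then have "finite (\<Union>n\<in>{n. \<not> low n a}. {t. rmul t a = x n})"
      by (simp add: weakly_cancellative_finite_rmul[OF wc])
    then show "finite {t. \<phi> A (a, t) \<noteq> 0}"
      by (rule rev_finite_subset) (auto simp: \<phi>_def indic_def)
  qed
  have \<phi>_Un: "\<phi> (A \<union> B) = (\<lambda>i. \<phi> A i + \<phi> B i)" if "A \<inter> B = {}" for A B
  proof
    fix i
    have "\<not> ((\<exists>n\<in>A. rmul t a = x n \<and> \<not> low n a) \<and> (\<exists>n\<in>B. rmul t a = x n \<and> \<not> low n a))" for a t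
      using that by (auto simp: inj_eq[OF x])
    then show "\<phi> (A \<union> B) i = \<phi> A i + \<phi> B i"
      by (cases i) (auto simp: \<phi>_def indic_def)
  qed

  \<comment> \<open>Each \<open>m k\<close> is a bounded finitely additive set function, and for
    fixed \<open>A\<close> it tends to 0 because \<open>\<rho>\<close> produces functions vanishing
    at infinity relative to \<open>\<omega>\<close>.\<close>
  define m where "m k A = Re (\<rho> (\<phi> A) (x k)) / \<omega> (x k)" for k A
  have m_add: "m k (A \<union> B) = m k A + m k B" if "A \<inter> B = {}" for k A B
    by (simp add: m_def \<phi>_Un[OF that] add[OF \<phi> \<phi>] add_divide_distrib)
  have m_bound: "\<bar>m k A\<bar> \<le> C" for k A
    using order_trans[OF abs_Re_le_cmod bound[OF \<phi> \<phi>_le, of A "x k"]] weight_pos[OF \<omega>, of "x k"]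
    by (simp add: m_def divide_le_eq)
  have m_lim: "(\<lambda>k. m k A) \<longlonglongrightarrow> 0" for A
  proof (rule LIMSEQ_I)
    fix d :: real assume d: "d > 0"
    have "finite (x -` {y. d * \<omega> y \<le> cmod (\<rho> (\<phi> A) y)})"
      by (rule finite_vimageI[OF vanish[OF \<phi> d] x])
    then obtain K where "x -` {y. d * \<omega> y \<le> cmod (\<rho> (\<phi> A) y)} \<subseteq> {..<K}"
      unfolding finite_nat_set_iff_bounded by auto
    then have "cmod (\<rho> (\<phi> A) (x k)) < d * \<omega> (x k)" if "k \<ge> K" for k
      using that by (force simp: not_le[symmetric])
    then have "norm (m k A - 0) < d" if "k \<ge> K" for k
      using le_less_trans[OF abs_Re_le_cmod] that weight_pos[OF \<omega>, of "x k"]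
      by (simp add: m_def divide_less_eq)
    then show "\<exists>K. \<forall>k\<ge>K. norm (m k A - 0) < d" by blast
  qed
  \<comment> \<open>Removing the low part from the full indicator subtracts from the value 1 a
    number of modulus at most 1/2.\<close>
  have "1 / 2 \<le> m k {k}" for k
  proof -
    let ?f = "\<lambda>(a, t). indic (rmul t a = x k)" and ?g = "\<lambda>(a, t). indic (rmul t a = x k \<and> low k a)"
    have f: "?f \<in> \<G>" using indicator_in_\<G>[of "x k" "\<lambda>_ _. True"] by simp
    have g: "?g \<in> \<G>" by (rule indicator_in_\<G>)
    have "\<phi> {k} = (\<lambda>i. of_real (\<omega> (x k)) * (?f i + (-1) * ?g i))"
      by (auto simp: \<phi>_def indic_def)
    then have "\<rho> (\<phi> {k}) (x k) = of_real (\<omega> (x k)) * (1 - \<Lambda> k (x k))"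
      using scale[OF \<G>_add[OF f \<G>_scale[OF g, of "-1"]], of "of_real (\<omega> (x k))" "x k"]
        add[OF f \<G>_scale[OF g, of "-1"], of "x k"] scale[OF g, of "-1" "x k"] unit[of "x k"]
      by (simp add: \<Lambda>_def)
    then have "m k {k} = 1 - Re (\<Lambda> k (x k))"
      using weight_pos[OF \<omega>, of "x k"] by (simp add: m_def)
    then show ?thesis
      using \<Lambda>_x[of k] complex_Re_le_cmod[of "\<Lambda> k (x k)"] by linarith
  qed
  moreover have "\<exists>k. m k {k} < 1 / 2"
    by (rule Phillips_diagonal[of m "\<lambda>_. C", OF m_add m_bound m_lim]) simp_all
  ultimately show False by (meson not_le)
qed

end

section \<open>From bi-injectivity to a retraction\<close>

text \<open>Boundedness comes for free: only finitely many values have modulus at least 1.\<close>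

lemma c0_eq_fibre_c0: "c0 = fibre_c0 (\<lambda>_. ())"
proof (intro equalityI subsetI)
  fix x :: "'s \<Rightarrow> complex" assume x: "x \<in> c0"
  let ?A = "{s. 1 \<le> cmod (x s)}"
  have fin: "finite ?A" using x by (simp add: c0_def)
  have "cmod (x s) \<le> 1 + (\<Sum>s\<in>?A. cmod (x s))" for s
  proof (cases "s \<in> ?A")
    case True
    then have "cmod (x s) \<le> (\<Sum>s\<in>?A. cmod (x s))"
      using fin by (intro member_le_sum) auto
    then show ?thesis by simp
  next
    case False
    moreover have "0 \<le> (\<Sum>s\<in>?A. cmod (x s))" by (rule sum_nonneg) simp
    ultimately show ?thesis by simp
  qed
  then have "bounded (range x)" by (rule bounded_rangeI)
  then show "x \<in> fibre_c0 (\<lambda>_. ())"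
    using x by (simp add: fibre_c0_def c0_def)
qed (simp add: fibre_c0_def c0_def)

text \<open>Without weights this says that composition with an equivariant map \<open>p\<close> is
  equivariant; the factor \<open>v (p i) / w i\<close> converts between the two
  normalisations.\<close>

lemma weighted_act_pullback:
  assumes w: "\<And>i. w i > 0" and v: "\<And>j. v j > 0" and p: "\<And>s i. p (l s i) = l' s (p i)"
  shows "weighted_act \<omega> w l a (\<lambda>i. of_real (v (p i) / w i) * x (p i))
    = (\<lambda>i. of_real (v (p i) / w i) * weighted_act \<omega> v l' a x (p i))"
proof
  fix i
  have "of_real (w (l s i) / (\<omega> s * w i)) * (of_real (v (p (l s i)) / w (l s i)) * x (p (l s i)))
      = of_real (v (p i) / w i) * (of_real (v (l' s (p i)) / (\<omega> s * v (p i))) * x (l' s (p i)))" for s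
  proof -
    have "w (l s i) / (\<omega> s * w i) * (v (p (l s i)) / w (l s i)) = v (p i) / w i * (v (l' s (p i)) / (\<omega> s * v (p i)))"
      using w[of "l s i"] v[of "p i"] by (simp add: p)
    then show ?thesis
      by (simp only: p of_real_mult[symmetric] mult.assoc[symmetric])
  qed
  then show "weighted_act \<omega> w l a (\<lambda>i. of_real (v (p i) / w i) * x (p i)) i
      = of_real (v (p i) / w i) * weighted_act \<omega> v l' a x (p i)"
    unfolding weighted_act_def infsum_cmult_right'[symmetric]
    by (simp only: mult.left_commute[of _ "a _"])
qed

text \<open>For functions on the unitization with values in \<open>c0\<close>, this shifts the
  argument \<open>a\<close>, while \<open>pair_ract\<close> acts on the values.\<close>

definition pair_lact :: "'s::semigroup_mult \<Rightarrow> 's option \<times> 's \<Rightarrow> 's option \<times> 's" where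
  "pair_lact s = (\<lambda>(a, t). (Some (lmul a s), t))"

definition pair_ract :: "'s::semigroup_mult \<Rightarrow> 's option \<times> 's \<Rightarrow> 's option \<times> 's" where
  "pair_ract s = (\<lambda>(a, t). (a, s * t))"

definition pair_mult :: "'s option \<times> 's \<Rightarrow> 's::semigroup_mult" where
  "pair_mult = (\<lambda>(a, t). rmul t a)"

lemma pair_mult_lact: "pair_mult (pair_lact s i) = pair_mult i * s"
  by (simp add: pair_mult_def pair_lact_def rmul_Some rmul_lmul split: prod.split)

lemma pair_mult_ract: "pair_mult (pair_ract s i) = s * pair_mult i"
  by (simp add: pair_mult_def pair_ract_def rmul_mult split: prod.split)

text \<open>\<open>base_bimod\<close> is \<open>c\<^sub>0(S)\<close> again, and \<open>pair_bimod\<close> is the bimodule \<open>G\<close> of the introduction.\<close>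

definition base_bimod :: "('s::semigroup_mult \<Rightarrow> real) \<Rightarrow> ('s, 's \<Rightarrow> complex) bimod" where
  "base_bimod \<omega> = fun_bimod \<omega> \<omega> (\<lambda>_. ()) (\<lambda>s y. y * s) (\<lambda>s y. s * y)"

definition pair_bimod :: "('s::semigroup_mult \<Rightarrow> real) \<Rightarrow> ('s, 's option \<times> 's \<Rightarrow> complex) bimod" where
  "pair_bimod \<omega> = fun_bimod \<omega> (pair_weight \<omega>) fst pair_lact pair_ract"

text \<open>Weights aside, this is composition with \<open>(a, t) \<mapsto> t a\<close>.\<close>

definition pair_embed :: "('s::semigroup_mult \<Rightarrow> real) \<Rightarrow> ('s \<Rightarrow> complex) \<Rightarrow> 's option \<times> 's \<Rightarrow> complex" where
  "pair_embed \<omega> x = (\<lambda>i. of_real (\<omega> (pair_mult i) / pair_weight \<omega> i) * x (pair_mult i))"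

section \<open>The complemented embedding into the pair bimodule and the resulting
  retraction\<close>

context
  fixes \<omega> :: "'s::semigroup_mult \<Rightarrow> real"
  assumes \<omega>: "weight \<omega>" and wc: "weakly_cancellative TYPE('s)"
begin

lemma weighted_action_base:
  "weighted_action \<omega> \<omega> (\<lambda>_. ()) (\<lambda>s y. y * s)" "weighted_action \<omega> \<omega> (\<lambda>_. ()) (\<lambda>s y. s * y)"
proof -
  have "\<omega> (s * t) \<le> \<omega> t * \<omega> s" for s t
    using weight_mult_le[OF \<omega>, of s t] by (simp add: mult.commute)
  then show "weighted_action \<omega> \<omega> (\<lambda>_. ()) (\<lambda>s y. y * s)" "weighted_action \<omega> \<omega> (\<lambda>_. ()) (\<lambda>s y. s * y)"
    by (unfold_locales; simp add: \<omega> weight_pos[OF \<omega>] weight_mult_le[OF \<omega>] weakly_cancellative_finite[OF wc])+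
qed

text \<open>\<open>pair_lact\<close> moves the fibre over \<open>a\<close> but keeps
  \<open>t\<close>, so it is injective on fibres; \<open>pair_ract\<close> keeps the fibre and is
  finite-to-one on it by weak cancellativity.\<close>

lemma weighted_action_pair:
  "weighted_action \<omega> (pair_weight \<omega>) fst pair_lact" "weighted_action \<omega> (pair_weight \<omega>) fst pair_ract"
proof -
  have fin_l: "finite {i. fst i = j \<and> pair_lact s i = i'}" for j s and i' :: "'s option \<times> 's"
    by (rule finite_subset[of _ "{(j, snd i')}"]) (auto simp: pair_lact_def)
  have fin_r: "finite {i. fst i = j \<and> pair_ract s i = i'}" for j s and i' :: "'s option \<times> 's"
    by (rule finite_subset[of _ "{j} \<times> {t. s * t = snd i'}"])
      (auto simp: pair_ract_def weakly_cancellative_finite[OF wc])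
  have fst: "fst (pair_lact s i) = Some (lmul (fst i) s)" "fst (pair_ract s i) = fst i" for s and i :: "'s option \<times> 's"
    by (simp_all add: pair_lact_def pair_ract_def case_prod_unfold)
  have le: "pair_weight \<omega> (pair_lact s i) \<le> \<omega> s * pair_weight \<omega> i"
    "pair_weight \<omega> (pair_ract s i) \<le> \<omega> s * pair_weight \<omega> i" for s i
    using pair_weight_lmul[OF \<omega>, of "fst i" s "snd i"] pair_weight_mult_left[OF \<omega>, of "fst i" s "snd i"]
    by (simp_all add: pair_lact_def pair_ract_def case_prod_unfold)
  show "weighted_action \<omega> (pair_weight \<omega>) fst pair_lact"
    by (unfold_locales; simp add: \<omega> pair_weight_pos[OF \<omega>] fin_l fst le)
  show "weighted_action \<omega> (pair_weight \<omega>) fst pair_ract"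
    by (unfold_locales; simp add: \<omega> pair_weight_pos[OF \<omega>] fin_r fst le)
qed

lemma banach_bimod_base: "banach_bimod \<omega> (base_bimod \<omega>)"
  unfolding base_bimod_def
  by (rule banach_bimod_fun_bimod[OF weighted_action_base]) (simp_all add: mult.assoc)

lemma banach_bimod_pair: "banach_bimod \<omega> (pair_bimod \<omega>)"
  unfolding pair_bimod_def
  by (rule banach_bimod_fun_bimod[OF weighted_action_pair])
    (simp_all add: pair_lact_def pair_ract_def lmul_mult mult.assoc split: prod.split)

lemma base_bimod_simps:
  "vcarrier (base_bimod \<omega>) = c0" "lact (base_bimod \<omega>) = weighted_act \<omega> \<omega> (\<lambda>s y. y * s)"
  "ract (base_bimod \<omega>) = (\<lambda>x a. weighted_act \<omega> \<omega> (\<lambda>s y. s * y) a x)"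
  "vadd (base_bimod \<omega>) = (\<lambda>x y i. x i + y i)" "vscal (base_bimod \<omega>) = (\<lambda>c x i. c * x i)"
  "vnorm (base_bimod \<omega>) = sup_norm"
  by (simp_all add: base_bimod_def fun_bimod_simps c0_eq_fibre_c0)

lemma pair_bimod_simps:
  "vcarrier (pair_bimod \<omega>) = fibre_c0 fst" "lact (pair_bimod \<omega>) = weighted_act \<omega> (pair_weight \<omega>) pair_lact"
  "ract (pair_bimod \<omega>) = (\<lambda>x a. weighted_act \<omega> (pair_weight \<omega>) pair_ract a x)"
  "vadd (pair_bimod \<omega>) = (\<lambda>x y i. x i + y i)" "vscal (pair_bimod \<omega>) = (\<lambda>c x i. c * x i)"
  "vnorm (pair_bimod \<omega>) = sup_norm" "vsub (pair_bimod \<omega>) = (\<lambda>x y i. x i - y i)"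
  by (simp_all add: pair_bimod_def fun_bimod_simps)

text \<open>Testing the dual actions on point masses: in \<open>conv_sum\<close> the sum over the
  \<open>delta\<close> factor collapses to the single point \<open>t\<close>.\<close>

lemma c0_bimod_act:
  assumes x: "x \<in> c0" and a: "a \<in> l1"
  shows "lact (c0_bimod \<omega>) a x = weighted_act \<omega> \<omega> (\<lambda>s y. y * s) a x"
    and "ract (c0_bimod \<omega>) x a = weighted_act \<omega> \<omega> (\<lambda>s y. s * y) a x"
proof -
  have le: "cmod (x u) \<le> sup_norm x" for u
    using x unfolding c0_eq_fibre_c0 by (rule fibre_c0_norm_le)
  have "pairing x (conv \<omega> (delta t) a) = weighted_act \<omega> \<omega> (\<lambda>s y. y * s) a x t" for t
    unfolding pairing_def mult.commute[of "x _"] conv_sum[OF \<omega> delta_in_l1 a le] sum_delta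
    by (simp add: weighted_act_def Omega_def mult.commute[of "\<omega> _" "\<omega> _"])
  then show "lact (c0_bimod \<omega>) a x = weighted_act \<omega> \<omega> (\<lambda>s y. y * s) a x"
    by (simp add: c0_bimod_def)
  have "pairing x (conv \<omega> a (delta t)) = weighted_act \<omega> \<omega> (\<lambda>s y. s * y) a x t" for t
    unfolding pairing_def mult.commute[of "x _"] conv_sum[OF \<omega> a delta_in_l1 le] sum_delta
    by (simp add: weighted_act_def Omega_def)
  then show "ract (c0_bimod \<omega>) x a = weighted_act \<omega> \<omega> (\<lambda>s y. s * y) a x"
    by (simp add: c0_bimod_def)
qed

lemma bimod_hom_base_c0: "bimod_hom (base_bimod \<omega>) (c0_bimod \<omega>) (\<lambda>x. x)"
  unfolding bimod_hom_def bounded_clinear_on_def base_bimod_simps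
proof (intro conjI ballI allI)
  show "\<exists>C. \<forall>x\<in>c0. vnorm (c0_bimod \<omega>) x \<le> C * sup_norm x"
    by (intro exI[of _ 1]) (simp add: c0_bimod_def sup_norm_def)
qed (simp_all add: c0_bimod_act, simp_all add: c0_bimod_def)

lemma embed_ratio: "0 \<le> \<omega> (pair_mult i) / pair_weight \<omega> i" "\<omega> (pair_mult i) / pair_weight \<omega> i \<le> 1"
  using pair_weight_rmul[OF \<omega>, of "snd i" "fst i"] pair_weight_pos[OF \<omega>, of i] weight_pos[OF \<omega>, of "pair_mult i"]
  by (simp_all add: pair_mult_def case_prod_beta less_imp_le)

lemma norm_pair_embed_le: "cmod (pair_embed \<omega> x i) \<le> cmod (x (pair_mult i))"
proof -
  have "\<bar>\<omega> (pair_mult i) / pair_weight \<omega> i\<bar> \<le> 1" using embed_ratio[of i] by simp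
  from mult_right_mono[OF this norm_ge_zero[of "x (pair_mult i)"]] show ?thesis
    by (simp only: pair_embed_def norm_mult norm_of_real mult_1)
qed

lemma pair_embed_None: "pair_embed \<omega> x (None, t) = x t"
  using weight_pos[OF \<omega>, of t] by (simp add: pair_embed_def pair_mult_def rmul_def pair_weight_def)

lemma pair_embed_in:
  assumes "x \<in> c0"
  shows "pair_embed \<omega> x \<in> fibre_c0 fst"
  unfolding fibre_c0_def mem_Collect_eq
proof (intro conjI allI impI)
  have x: "x \<in> fibre_c0 (\<lambda>_. ())" using assms by (simp add: c0_eq_fibre_c0)
  show "bounded (range (pair_embed \<omega> x))"
    by (rule bounded_rangeI) (rule order_trans[OF norm_pair_embed_le fibre_c0_norm_le[OF x]])
  fix a and e :: real assume "e > 0"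
  then have fin: "finite {u. e \<le> cmod (x u)}"
    using assms by (simp add: c0_def)
  have "finite (\<Union>u\<in>{u. e \<le> cmod (x u)}. {a} \<times> {t. rmul t a = u})"
    by (intro finite_UN_I fin finite_cartesian_product weakly_cancellative_finite_rmul[OF wc]) simp
  moreover have "{i. fst i = a \<and> e \<le> cmod (pair_embed \<omega> x i)} \<subseteq> (\<Union>u\<in>{u. e \<le> cmod (x u)}. {a} \<times> {t. rmul t a = u})"
  proof
    fix i assume "i \<in> {i. fst i = a \<and> e \<le> cmod (pair_embed \<omega> x i)}"
    then show "i \<in> (\<Union>u\<in>{u. e \<le> cmod (x u)}. {a} \<times> {t. rmul t a = u})"
      using order_trans[OF _ norm_pair_embed_le, of e x i] by (cases i) (simp add: pair_mult_def)
  qed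
  ultimately show "finite {i. fst i = a \<and> e \<le> cmod (pair_embed \<omega> x i)}"
    by (rule rev_finite_subset)
qed

lemma pair_restrict_in:
  assumes "\<phi> \<in> fibre_c0 fst"
  shows "(\<lambda>t. \<phi> (None, t)) \<in> c0"
  unfolding c0_def mem_Collect_eq
proof (intro allI impI)
  fix e :: real assume "e > 0"
  from fibre_c0_finite[OF assms this, of None]
  have "finite (snd ` {i. fst i = None \<and> e \<le> cmod (\<phi> i)})" by (rule finite_imageI)
  then show "finite {s. e \<le> cmod (\<phi> (None, s))}"
    by (rule rev_finite_subset) (force simp: image_iff)
qed

lemma bounded_clinear_on_pair_embed: "bounded_clinear_on (base_bimod \<omega>) (pair_bimod \<omega>) (pair_embed \<omega>)"
  unfolding bounded_clinear_on_def base_bimod_simps pair_bimod_simps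
proof (intro conjI ballI allI)
  have "sup_norm (pair_embed \<omega> x) \<le> 1 * sup_norm x" if "x \<in> c0" for x
    using that unfolding c0_eq_fibre_c0 mult_1
    by (intro sup_norm_least order_trans[OF norm_pair_embed_le] fibre_c0_norm_le)
  then show "\<exists>C. \<forall>x\<in>c0. sup_norm (pair_embed \<omega> x) \<le> C * sup_norm x" by blast
qed (simp_all add: pair_embed_in, simp_all add: pair_embed_def fun_eq_iff distrib_left)

lemma bimod_hom_pair_embed: "bimod_hom (base_bimod \<omega>) (pair_bimod \<omega>) (pair_embed \<omega>)"
  unfolding bimod_hom_def base_bimod_simps pair_bimod_simps
  using weighted_act_pullback[of "pair_weight \<omega>" \<omega> pair_mult pair_lact "\<lambda>s y. y * s" \<omega>]
    weighted_act_pullback[of "pair_weight \<omega>" \<omega> pair_mult pair_ract "\<lambda>s y. s * y" \<omega>]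
  by (simp add: bounded_clinear_on_pair_embed pair_embed_def pair_weight_pos[OF \<omega>] weight_pos[OF \<omega>]
      pair_mult_lact pair_mult_ract)

lemma inj_on_pair_embed: "inj_on (pair_embed \<omega>) c0"
proof (rule inj_onI)
  fix x y assume "pair_embed \<omega> x = pair_embed \<omega> y"
  then have "pair_embed \<omega> x (None, t) = pair_embed \<omega> y (None, t)" for t by simp
  then show "x = y" unfolding pair_embed_None by (rule ext)
qed

text \<open>The range consists of the functions determined by their restriction to the adjoined unit
  through \<open>pair_embed\<close>, a condition that survives pointwise limits.\<close>

lemma closed_pair_embed: "closed_in_bimod (pair_bimod \<omega>) (pair_embed \<omega> ` c0)"
  unfolding closed_in_bimod_def pair_bimod_simps
proof (intro allI impI, elim conjE)
  fix X y assume X: "\<forall>n. X n \<in> pair_embed \<omega> ` c0" and y: "y \<in> fibre_c0 fst"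
    and lim: "(\<lambda>n. sup_norm (\<lambda>i. X n i - y i)) \<longlonglongrightarrow> 0"
  obtain x where x: "\<And>n. x n \<in> c0" "\<And>n. X n = pair_embed \<omega> (x n)"
    using X unfolding image_iff by metis
  have diff: "(\<lambda>i. X n i - y i) \<in> fibre_c0 fst" for n
    using fibre_c0_add[OF pair_embed_in[OF x(1)[of n]] fibre_c0_scale[OF y, of "-1"]] by (simp add: x(2))
  have pt: "(\<lambda>n. X n i) \<longlonglongrightarrow> y i" for i
  proof (rule LIM_zero_cancel, rule Lim_null_comparison[OF _ lim])
    show "\<forall>\<^sub>F n in sequentially. norm (X n i - y i) \<le> sup_norm (\<lambda>i. X n i - y i)"
      using fibre_c0_norm_le[OF diff] by (intro always_eventually allI)
  qed
  have "y = pair_embed \<omega> (\<lambda>t. y (None, t))"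
  proof
    fix i
    have "X n i = of_real (\<omega> (pair_mult i) / pair_weight \<omega> i) * X n (None, pair_mult i)" for n
      unfolding x(2) pair_embed_None by (simp only: pair_embed_def)
    then have "(\<lambda>n. X n i) \<longlonglongrightarrow> of_real (\<omega> (pair_mult i) / pair_weight \<omega> i) * y (None, pair_mult i)"
      by (simp only:) (intro tendsto_mult tendsto_const pt)
    then show "y i = pair_embed \<omega> (\<lambda>t. y (None, t)) i"
      unfolding pair_embed_def by (rule LIMSEQ_unique[OF pt])
  qed
  then show "y \<in> pair_embed \<omega> ` c0"
    using pair_restrict_in[OF y] by (rule image_eqI)
qed

lemma complemented_pair_embed: "complemented_in (pair_bimod \<omega>) (pair_embed \<omega> ` c0)"
  unfolding complemented_in_def
proof (intro exI conjI ballI)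
  let ?P = "\<lambda>\<phi>. pair_embed \<omega> (\<lambda>t. \<phi> (None, t))"
  show "bounded_clinear_on (pair_bimod \<omega>) (pair_bimod \<omega>) ?P"
    unfolding bounded_clinear_on_def pair_bimod_simps
  proof (intro conjI ballI allI)
    have "sup_norm (?P \<phi>) \<le> 1 * sup_norm \<phi>" if "\<phi> \<in> fibre_c0 fst" for \<phi>
      unfolding mult_1
      by (intro sup_norm_least order_trans[OF norm_pair_embed_le] fibre_c0_norm_le[OF that])
    then show "\<exists>C. \<forall>\<phi>\<in>fibre_c0 fst. sup_norm (?P \<phi>) \<le> C * sup_norm \<phi>" by blast
  qed (simp_all add: pair_embed_in pair_restrict_in, simp_all add: pair_embed_def fun_eq_iff distrib_left)
  show "?P (?P \<phi>) = ?P \<phi>" for \<phi>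
    by (simp add: pair_embed_None)
  show "?P ` vcarrier (pair_bimod \<omega>) = pair_embed \<omega> ` c0"
  proof (intro equalityI subsetI)
    fix y assume "y \<in> pair_embed \<omega> ` c0"
    then obtain x where x: "x \<in> c0" "y = pair_embed \<omega> x" by blast
    then have "y = ?P y" by (simp add: pair_embed_None)
    then show "y \<in> ?P ` vcarrier (pair_bimod \<omega>)"
      using pair_embed_in[OF x(1)] x(2) unfolding pair_bimod_simps by blast
  qed (auto simp: pair_bimod_simps pair_restrict_in)
qed

text \<open>Extending the identity of \<open>c0\<close> along \<open>pair_embed\<close> gives a
  bimodule map \<open>r\<close>; point masses turn its module property into compatibility with
  translations.\<close>

lemma bi_injective_translation_retract:
  assumes inf: "infinite (UNIV :: 's set)"
    and inj: "bi_injective TYPE('s set set) TYPE('s set set) \<omega> (c0_bimod \<omega>)"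
  obtains \<rho> \<G> C where "translation_retract \<omega> \<rho> \<G> C"
proof -
  obtain K :: "('s option \<times> 's \<Rightarrow> complex) \<Rightarrow> 's set set" where K: "inj K"
    using inj_function_encoding[OF inf] by blast
  \<comment> \<open>Functions on the semigroup are first viewed as functions on pairs, so that one
    encoding \<open>K\<close> serves both carriers.\<close>
  have "inj (\<lambda>x :: 's \<Rightarrow> complex. \<lambda>i :: 's option \<times> 's. x (snd i))"
    by (rule injI) (simp add: fun_eq_iff)
  from inj_compose[OF K this]
  have J: "inj (K \<circ> (\<lambda>x :: 's \<Rightarrow> complex. \<lambda>i. x (snd i)))" .
  obtain r where hom: "bimod_hom (pair_bimod \<omega>) (c0_bimod \<omega>) r"
    and retract: "\<And>x. x \<in> c0 \<Longrightarrow> r (pair_embed \<omega> x) = x"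
    using bi_injective_extend[OF inj J K banach_bimod_base banach_bimod_pair bimod_hom_pair_embed _ _ _ bimod_hom_base_c0]
      inj_on_pair_embed closed_pair_embed complemented_pair_embed unfolding base_bimod_simps by blast
  have r_c0: "r \<phi> \<in> c0" if "\<phi> \<in> fibre_c0 fst" for \<phi>
    using hom that unfolding bimod_hom_def bounded_clinear_on_def pair_bimod_simps by (simp add: c0_bimod_def)
  have r_add: "r (\<lambda>i. \<phi> i + \<psi> i) = (\<lambda>y. r \<phi> y + r \<psi> y)" if "\<phi> \<in> fibre_c0 fst" "\<psi> \<in> fibre_c0 fst" for \<phi> \<psi>
    using hom that unfolding bimod_hom_def bounded_clinear_on_def pair_bimod_simps by (simp add: c0_bimod_def)
  have r_scale: "r (\<lambda>i. c * \<phi> i) = (\<lambda>y. c * r \<phi> y)" if "\<phi> \<in> fibre_c0 fst" for c \<phi>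
    using hom that unfolding bimod_hom_def bounded_clinear_on_def pair_bimod_simps by (simp add: c0_bimod_def)
  obtain C0 where "\<forall>\<phi>\<in>fibre_c0 fst. vnorm (c0_bimod \<omega>) (r \<phi>) \<le> C0 * sup_norm \<phi>"
    using hom unfolding bimod_hom_def bounded_clinear_on_def pair_bimod_simps by blast
  then have C0: "sup_norm (r \<phi>) \<le> C0 * sup_norm \<phi>" if "\<phi> \<in> fibre_c0 fst" for \<phi>
    using that by (simp add: c0_bimod_def sup_norm_def)
  \<comment> \<open>A nonnegative constant, as needed for monotonicity of the product with
    \<open>B\<close>.\<close>
  define C where "C = max C0 0"
  have r_norm: "cmod (r \<phi> y) \<le> C * B" if "\<phi> \<in> fibre_c0 fst" "\<And>i. cmod (\<phi> i) \<le> B" for \<phi> y B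
  proof -
    have "cmod (r \<phi> y) \<le> sup_norm (r \<phi>)"
      using r_c0[OF that(1)] unfolding c0_eq_fibre_c0 by (rule fibre_c0_norm_le)
    also have "\<dots> \<le> C0 * sup_norm \<phi>" by (rule C0[OF that(1)])
    also have "\<dots> \<le> C * B"
      using sup_norm_least[of \<phi> B] that(2) fibre_c0_sup_norm_nonneg[OF that(1)]
      by (intro mult_mono) (auto simp: C_def)
    finally show ?thesis .
  qed
  have r_act: "r (weighted_act \<omega> (pair_weight \<omega>) pair_lact (delta s) \<phi>) = weighted_act \<omega> \<omega> (\<lambda>s y. y * s) (delta s) (r \<phi>)"
    "r (weighted_act \<omega> (pair_weight \<omega>) pair_ract (delta s) \<phi>) = weighted_act \<omega> \<omega> (\<lambda>s y. s * y) (delta s) (r \<phi>)"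
    if "\<phi> \<in> fibre_c0 fst" for \<phi> s
    using hom that delta_in_l1[of s] c0_bimod_act[OF r_c0[OF that] delta_in_l1[of s]]
    unfolding bimod_hom_def pair_bimod_simps by simp_all
  interpret bl: weighted_action \<omega> \<omega> "\<lambda>_. ()" "\<lambda>s y. y * s" by (rule weighted_action_base)
  interpret br: weighted_action \<omega> \<omega> "\<lambda>_. ()" "\<lambda>s y. s * y" by (rule weighted_action_base)
  interpret pl: weighted_action \<omega> "pair_weight \<omega>" fst pair_lact by (rule weighted_action_pair)
  interpret pr: weighted_action \<omega> "pair_weight \<omega>" fst pair_ract by (rule weighted_action_pair)

  define norml where "norml f = (\<lambda>i. f i / complex_of_real (pair_weight \<omega> i))" for f
  define \<rho> where "\<rho> f y = of_real (\<omega> y) * r (norml f) y" for f y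
  define \<G> where "\<G> = {f. (\<exists>B. \<forall>i. cmod (f i) \<le> B * pair_weight \<omega> i) \<and> (\<forall>a. finite {t. f (a, t) \<noteq> 0})}"
  have norml_le: "cmod (norml f i) \<le> B" if "\<And>i. cmod (f i) \<le> B * pair_weight \<omega> i" for f B i
    using that[of i] pair_weight_pos[OF \<omega>, of i] by (simp add: norml_def norm_divide pos_divide_le_eq)
  have norml: "norml f \<in> fibre_c0 fst" if f: "f \<in> \<G>" for f
  proof -
    obtain B where B: "\<And>i. cmod (f i) \<le> B * pair_weight \<omega> i" "\<And>a. finite {t. f (a, t) \<noteq> 0}"
      using f by (auto simp: \<G>_def)
    have "finite {i. fst i = a \<and> e \<le> cmod (norml f i)}" if "e > 0" for a e
      using that by (intro finite_subset[OF _ finite_cartesian_product[of "{a}", OF _ B(2)[of a]]])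
        (auto simp: norml_def)
    then show ?thesis
      using bounded_rangeI[OF norml_le[OF B(1)]] by (simp add: fibre_c0_def)
  qed
  \<comment> \<open>Left and right translations are treated at once: \<open>delta s\<close>
    translates up to the factor \<open>1 / \<omega> s\<close>, which scaling by
    \<open>\<omega> s\<close> removes.\<close>
  have translate: "\<rho> (\<lambda>i. f (l s i)) y = \<rho> f (l' s y)"
    if f: "f \<in> \<G>" and pos: "\<omega> s > 0"
      and act: "r (weighted_act \<omega> (pair_weight \<omega>) l (delta s) (norml f)) = weighted_act \<omega> \<omega> l' (delta s) (r (norml f))"
      and l: "weighted_action \<omega> (pair_weight \<omega>) (fst :: 's option \<times> 's \<Rightarrow> _) l"
      and l': "weighted_action \<omega> \<omega> (\<lambda>_. ()) l'"
    for f s y l l'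
  proof -
    have "norml (\<lambda>i. f (l s i)) = (\<lambda>i. of_real (\<omega> s) * weighted_act \<omega> (pair_weight \<omega>) l (delta s) (norml f) i)"
      using pos pair_weight_pos[OF \<omega>]
      by (auto simp: weighted_action.act_delta[OF l] norml_def fun_eq_iff less_imp_neq[symmetric])
    then have "r (norml (\<lambda>i. f (l s i))) y = of_real (\<omega> s) * weighted_act \<omega> \<omega> l' (delta s) (r (norml f)) y"
      using r_scale[OF weighted_action.fibre_c0_act[OF l delta_in_l1 norml[OF f]]] act by simp
    then show ?thesis
      using pos weight_pos[OF \<omega>, of y] by (simp add: \<rho>_def weighted_action.act_delta[OF l'])
  qed
  have "translation_retract \<omega> \<rho> \<G> C"
  proof
    fix f g y assume f: "f \<in> \<G>" and g: "g \<in> \<G>"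
    show "\<rho> (\<lambda>i. f i + g i) y = \<rho> f y + \<rho> g y"
      using r_add[OF norml[OF f] norml[OF g]] by (simp add: \<rho>_def norml_def add_divide_distrib distrib_left)
  next
    fix f y c assume f: "f \<in> \<G>"
    show "\<rho> (\<lambda>i. c * f i) y = c * \<rho> f y"
      using r_scale[OF norml[OF f], of c] by (simp add: \<rho>_def norml_def)
  next
    fix f B y assume f: "f \<in> \<G>" and B: "\<And>i. cmod (f i) \<le> B * pair_weight \<omega> i"
    show "cmod (\<rho> f y) \<le> C * B * \<omega> y"
      using mult_right_mono[OF r_norm[OF norml[OF f] norml_le[OF B], of y], of "\<omega> y"] weight_pos[OF \<omega>, of y]
      by (simp add: \<rho>_def norm_mult mult.commute)
  next
    fix f and e :: real assume f: "f \<in> \<G>" and e: "e > 0"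
    have "e * \<omega> y \<le> cmod (\<rho> f y) \<longleftrightarrow> e \<le> cmod (r (norml f) y)" for y
      using weight_pos[OF \<omega>, of y] by (simp add: \<rho>_def norm_mult mult.commute[of e])
    then show "finite {y. e * \<omega> y \<le> cmod (\<rho> f y)}"
      using r_c0[OF norml[OF f]] e by (simp add: c0_def)
  next
    fix f s y assume f: "f \<in> \<G>"
    show "\<rho> (\<lambda>(a, t). f (Some (lmul a s), t)) y = \<rho> f (y * s)"
      using translate[OF f weight_pos[OF \<omega>] r_act(1)[OF norml[OF f]] weighted_action_pair(1) weighted_action_base(1), of s y]
      by (simp add: pair_lact_def case_prod_unfold)
    show "\<rho> (\<lambda>(a, t). f (a, s * t)) y = \<rho> f (s * y)"
      using translate[OF f weight_pos[OF \<omega>] r_act(2)[OF norml[OF f]] weighted_action_pair(2) weighted_action_base(2), of s y]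
      by (simp add: pair_ract_def case_prod_unfold)
  next
    fix x :: 's
    have dx: "delta x \<in> c0"
      unfolding c0_def by (auto intro: finite_subset[of _ "{x}"] simp: delta_def)
    \<comment> \<open>Up to the factor \<open>1 / \<omega> x\<close>, the normalised indicator is
      the embedded point mass at \<open>x\<close>, which \<open>r\<close> sends back to that point
      mass.\<close>
    have "norml (\<lambda>(a, t). indic (rmul t a = x)) = (\<lambda>i. of_real (1 / \<omega> x) * pair_embed \<omega> (delta x) i)"
      using weight_pos[OF \<omega>, of x]
      by (auto simp: norml_def indic_def pair_embed_def pair_mult_def delta_def fun_eq_iff)
    then have "r (norml (\<lambda>(a, t). indic (rmul t a = x))) = (\<lambda>y. of_real (1 / \<omega> x) * delta x y)"
      using r_scale[OF pair_embed_in[OF dx], of "of_real (1 / \<omega> x)"] retract[OF dx] by simp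
    then show "\<rho> (\<lambda>(a, t). indic (rmul t a = x)) x = 1"
      using weight_pos[OF \<omega>, of x] by (simp add: \<rho>_def delta_def)
  qed (simp_all add: \<omega> wc \<G>_def)
  then show thesis by (rule that)
qed

end

theorem theorem5p24:
  fixes \<omega> :: "'s::semigroup_mult \<Rightarrow> real"
  assumes "infinite (UNIV :: 's set)"
    and "weakly_cancellative TYPE('s)"
    and "weight \<omega>"
    and "unital TYPE('s) \<or> cancellative TYPE('s)"
  shows "\<not> bi_injective TYPE('s set set) TYPE('s set set) \<omega> (c0_bimod \<omega>)"
proof
  assume "bi_injective TYPE('s set set) TYPE('s set set) \<omega> (c0_bimod \<omega>)"
  then obtain \<rho> \<G> C where "translation_retract \<omega> \<rho> \<G> C"
    using bi_injective_translation_retract[OF assms(3,2,1)] by blast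
  then interpret translation_retract \<omega> \<rho> \<G> C .
  show False
    using assms(4) cancellative_unital not_unital[OF assms(1)] by blast
qed

end
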